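(* Let $c:\mathbb{R}^n\to\mathbb{R}^m$, $f:\mathbb{R}^m\to\mathbb{R}$, $A\in\mathbb{R}^{k\times m}$, $b\in\mathbb{R}^k$ and $S\subset\mathbb{R}^n$ satisfy the standing setting and the Smoothness, Quadratic growth and Constraint qualification assumptions listed in the context, with constants $L_{\varphi_f}$, $\alpha_{\varphi_f}$, $\gamma$, and let $\Lambda$ be the threshold defined in the context. Then there exist a constant $\ell\le 5$ and a neighborhood $\mathcal{N}(S,\varepsilon)$, $\varepsilon>0$, such that for every penalty parameter $\lambda\ge\Lambda$ the penalized objective $\varphi(x)=f(c(x))+\lambda\|Ac(x)-b\|_2$ satisfies, for all $x\in\mathcal{N}(S,\varepsilon)$, the norm convexity inequality $$\varphi(x)-\varphi_\star\le \ell\cdot \mathrm{dist}(0,\partial\varphi(x))\cdot\mathrm{dist}(x,S).$$ Consequently, sub-differential regularity holds: for all $x\in\mathcal{N}(S,\varepsilon)$, $$\mathrm{dist}(x,S)\le\widetilde{\ell}\cdot\mathrm{dist}(0,\partial\varphi(x)),\qquad \widetilde{\ell}=\frac{4\ell}{\alpha_{\varphi_f}}.$$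
   Context: Setting. $c:\mathbb{R}^n\to\mathbb{R}^m$ is a smooth map, $f:\mathbb{R}^m\to\mathbb{R}$ is convex, $A\in\mathbb{R}^{k\times m}$, $b\in\mathbb{R}^k$; the constrained problem is to minimize $f(c(x))$ subject to $Ac(x)-b=0$. Write $\varphi_f(x)=f(c(x))$, $\varphi_g(x)=\|Ac(x)-b\|_2$, $\varphi=\varphi_f+\lambda\varphi_g$. $\nabla c(x)\in\mathbb{R}^{n\times m}$ is the transposed Jacobian. $\mathrm{dist}(x,S)=\inf_{y\in S}\|x-y\|_2$ and $\mathcal{N}(S,\varepsilon)=\{x:\mathrm{dist}(x,S)\le\varepsilon\}$. $S$ is a local minimizing set of the constrained problem: points of $S$ are feasible, $\varphi_f(x_\star)=\varphi_\star$ for every $x_\star\in S$, and for some $\varepsilon_0>0$, $\varphi_f(x)\ge\varphi_\star$ for all $x\in\mathcal{N}(S,\varepsilon_0)$ with $Ac(x)=b$. The same $\varepsilon_0$ is used in all assumptions below. Smoothness. On $\mathcal{N}(S,\varepsilon_0)$, $\varphi_f$ is $C^2$ with $\|\nabla^2\varphi_f(x)\|_{\mathrm{op}}\le\beta_{\varphi_f}$ and $\|\nabla^2\varphi_f(x_1)-\nabla^2\varphi_f(x_2)\|_{\mathrm{op}}\le\rho_{\varphi_f}\|x_1-x_2\|_2$, and $\varphi_f$ is $L_{\varphi_f}$-Lipschitz ($L_{\varphi_f}>0$). The functions $f$ and $c$ are also smooth in the same sense with corresponding parameters (for example, $\nabla c$ is $\beta_c$-Lipschitz). Quadratic growth. There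 is $\alpha_{\varphi_f}>0$ with $\varphi_f(x)\ge\varphi_\star+\frac{\alpha_{\varphi_f}}{2}\mathrm{dist}(x,S)^2$ for all $x\in\mathcal{N}(S,\varepsilon_0)$ with $Ac(x)=b$. Constraint qualification. There is $\gamma>0$ such that for all $x\in\mathcal{N}(S,\varepsilon_0)$ the matrix $A\nabla c(x)^\top\in\mathbb{R}^{k\times n}$ has full row rank and $\sigma_{\min}(A\nabla c(x)^\top)\ge\gamma$. Consequently, in $\mathcal{N}(S,\varepsilon_0)$, $\mathcal{M}=\{x\in\mathbb{R}^n:Ac(x)=b\}$ is a smooth manifold; further $S$ is assumed to be a compact smooth submanifold of $\mathcal{M}$. Sub-differential. For $h(y)=f(y)+\lambda\|Ay-b\|_2$, so that $\varphi=h\circ c$, $\partial\varphi(x)=\{\nabla c(x)g: g\in\partial h(c(x))\}$. Threshold. $\Lambda=\max\{\Lambda_{\mathrm{qg}},\Lambda_{\mathrm{proj}}\}$ with $\Lambda_{\mathrm{qg}}=2L_{\varphi_f}/\gamma$ and $\Lambda_{\mathrm{proj}}=2\sup_{x\in S}\|z(x)\|_2$, where $z(x)=\arg\min_{z\in\mathbb{R}^k}\|\nabla\varphi_f(x)+\nabla c(x)A^\top z\|_2$. *)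

theory Defs
  imports "HOL-Analysis.Analysis"
begin

definition nbhd :: "'a::metric_space set \<Rightarrow> real \<Rightarrow> 'a set" where
  "nbhd S e = {x. infdist x S \<le> e}"

definition deriv1 :: "('a::real_normed_vector \<Rightarrow> 'b::real_normed_vector) \<Rightarrow> 'a \<Rightarrow> ('a \<Rightarrow>\<^sub>L 'b)" where
  "deriv1 g x = Blinfun (frechet_derivative g (at x))"

text \<open>For real-valued g, the functional deriv2 g x u applied to v is the Hessian form of g at x in the
  directions u and v, so norm (deriv2 g x) is the operator norm of the Hessian matrix.\<close>

definition deriv2 ::
    "('a::real_normed_vector \<Rightarrow> 'b::real_normed_vector) \<Rightarrow> 'a \<Rightarrow> ('a \<Rightarrow>\<^sub>L ('a \<Rightarrow>\<^sub>L 'b))" where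
  "deriv2 g = deriv1 (deriv1 g)"

text \<open>Only meaningful for open U, since the derivatives are taken in the ambient space.\<close>

definition C2_on :: "'a::real_normed_vector set \<Rightarrow> ('a \<Rightarrow> 'b::real_normed_vector) \<Rightarrow> bool" where
  "C2_on U g \<longleftrightarrow>
     (\<forall>x\<in>U. g differentiable (at x)) \<and> (\<forall>x\<in>U. deriv1 g differentiable (at x)) \<and>
     continuous_on U (deriv2 g)"

text \<open>X need not be open: being C2 on X means being C2 on an open set containing X.\<close>

definition smooth_with ::
    "real \<Rightarrow> real \<Rightarrow> real \<Rightarrow> 'a::real_normed_vector set \<Rightarrow> ('a \<Rightarrow> 'b::real_normed_vector) \<Rightarrow> bool" where
  "smooth_with L \<beta> \<rho> X g \<longleftrightarrow>
     (\<exists>U. open U \<and> X \<subseteq> U \<and> C2_on U g) \<and>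
     (\<forall>x\<in>X. norm (deriv2 g x) \<le> \<beta>) \<and>
     \<rho>-lipschitz_on X (deriv2 g) \<and>
     L-lipschitz_on X g"

definition gradient :: "('a::real_inner \<Rightarrow> real) \<Rightarrow> 'a \<Rightarrow> 'a" where
  "gradient g x = (THE v. GDERIV g x :> v)"

definition nabla :: "(real^'n \<Rightarrow> real^'m) \<Rightarrow> real^'n \<Rightarrow> real^'m^'n" where
  "nabla c x = transpose (jacobian c (at x))"

text \<open>S is an embedded submanifold of the set M (of class C2) when around each point of S some
  C2 diffeomorphism of open subsets of the ambient space straightens M and S simultaneously to
  linear subspaces K and L. The dimensions may vary between connected components.\<close>

definition submanifold_of :: "'a::euclidean_space set \<Rightarrow> 'a set \<Rightarrow> bool" where
  "submanifold_of S M \<longleftrightarrow>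
     S \<subseteq> M \<and>
     (\<forall>p\<in>S. \<exists>U V \<psi> \<theta> (K :: 'a set) L.
        open U \<and> p \<in> U \<and> open V \<and> homeomorphism U V \<psi> \<theta> \<and> C2_on U \<psi> \<and> C2_on V \<theta> \<and>
        subspace K \<and> subspace L \<and> L \<subseteq> K \<and>
        \<psi> ` (U \<inter> M) = V \<inter> K \<and> \<psi> ` (U \<inter> S) = V \<inter> L)"

text \<open>Requiring a left and a right singular vector yields exactly the singular values of the
  singular value decomposition, min k n many with multiplicity, for a k by n matrix of any shape.\<close>

definition singular_values :: "real^'n^'k \<Rightarrow> real set" where
  "singular_values B =
     {s. 0 \<le> s \<and> (\<exists>u v. norm u = 1 \<and> norm v = 1 \<and>
                          B *v v = s *\<^sub>R u \<and> transpose B *v u = s *\<^sub>R v)}"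

definition sigma_min :: "real^'n^'k \<Rightarrow> real" where
  "sigma_min B = Min (singular_values B)"

definition subdifferential :: "('a::real_inner \<Rightarrow> real) \<Rightarrow> 'a \<Rightarrow> 'a set" where
  "subdifferential h y = {v. \<forall>w. h y + v \<bullet> (w - y) \<le> h w}"

definition composite_subdifferential ::
    "(real^'m \<Rightarrow> real) \<Rightarrow> (real^'n \<Rightarrow> real^'m) \<Rightarrow> real^'n \<Rightarrow> (real^'n) set" where
  "composite_subdifferential h c x = (\<lambda>v. nabla c x *v v) ` subdifferential h (c x)"

definition penalized ::
    "(real^'m \<Rightarrow> real) \<Rightarrow> real^'m^'k \<Rightarrow> real^'k \<Rightarrow> real \<Rightarrow> real^'m \<Rightarrow> real" where
  "penalized f A b lam y = f y + lam * norm (A *v y - b)"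

definition multiplier ::
    "(real^'m \<Rightarrow> real) \<Rightarrow> (real^'n \<Rightarrow> real^'m) \<Rightarrow> real^'m^'k \<Rightarrow> real^'n \<Rightarrow> real^'k" where
  "multiplier f c A x =
     arg_min (\<lambda>z. norm (gradient (f \<circ> c) x + (nabla c x ** transpose A) *v z)) (\<lambda>_. True)"

definition threshold ::
    "(real^'m \<Rightarrow> real) \<Rightarrow> (real^'n \<Rightarrow> real^'m) \<Rightarrow> real^'m^'k \<Rightarrow> (real^'n) set \<Rightarrow>
     real \<Rightarrow> real \<Rightarrow> real" where
  "threshold f c A S L \<gamma> = max (2 * L / \<gamma>) (2 * (SUP x\<in>S. norm (multiplier f c A x)))"

end

theory Submission
  imports Defs
begin

text \<open>
  Write \<open>p = f \<circ> c\<close>, \<open>F x = A *v c x - b\<close>, let \<open>J x\<close> be the derivative of \<open>F\<close> at \<open>x\<close> and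
  \<open>J\<^sup>T\<close> its adjoint, let \<open>x\<^sub>*\<close> be a nearest point of \<open>S\<close> to \<open>x\<close>, \<open>d = x - x\<^sub>*\<close> and
  \<open>r = \<parallel>d\<parallel>\<close>. The bound on the least singular value says \<open>\<gamma> \<parallel>z\<parallel> \<le> \<parallel>J\<^sup>T z\<parallel>\<close>. The constant
  \<open>l = 2\<close> works, and the two kinds of points near \<open>S\<close> have different reasons.

  Infeasible points. There the penalized objective is differentiable and its only subgradient is
  \<open>w = \<nabla>p + \<lambda> J\<^sup>T u\<close> with the unit vector \<open>u = sgn (F x)\<close>. From \<open>\<lambda> \<gamma> \<ge> 2 L\<close> follows
  \<open>\<parallel>w\<parallel> \<ge> \<lambda> \<gamma> - L \<ge> \<lambda> \<gamma> / 2 \<ge> L\<close>. First-order expansions of \<open>p\<close> and \<open>F\<close> bound the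
  gap, that is the penalized objective minus its value on \<open>S\<close>, by \<open>w \<bullet> d + O(1 + \<lambda>) r\<^sup>2\<close>; as
  \<open>\<parallel>w\<parallel>\<close> itself grows like \<open>\<lambda>\<close>, the error is at most \<open>\<parallel>w\<parallel> r\<close> on a neighbourhood that does not depend on \<open>\<lambda>\<close>.

  Feasible points. Every subgradient has the form \<open>w = \<nabla>p x + J\<^sup>T z\<close>, and the argument uses
  nothing else about \<open>z\<close>, which makes it uniform in \<open>\<lambda>\<close>. At \<open>x\<^sub>*\<close> there is a Lagrange
  multiplier \<open>z\<^sub>0\<close> with \<open>\<parallel>z\<^sub>0\<parallel> \<le> L / \<gamma>\<close>; the Lagrangian \<open>p + z\<^sub>0 \<bullet> F\<close> is stationary at
  \<open>x\<^sub>*\<close> and agrees with \<open>p\<close> on the feasible set. The trapezoid rule on the segment from \<open>x\<^sub>*\<close>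
  to \<open>x\<close>, where the left end contributes nothing, gives
  \<open>p x - p x\<^sub>* = (\<nabla>p x + J\<^sup>T z\<^sub>0) \<bullet> d / 2 + O(r\<^sup>3)\<close>. Replacing \<open>z\<^sub>0\<close> by \<open>z\<close> costs
  \<open>(z\<^sub>0 - z) \<bullet> J d\<close>. Here \<open>J d = O(r\<^sup>2)\<close>, because both ends are feasible, and
  \<open>\<parallel>z\<^sub>0 - z\<parallel> = O(\<parallel>w\<parallel> + r)\<close> by the singular value bound. So the gap is at most
  \<open>(1/2 + O(r)) \<parallel>w\<parallel> r + O(r\<^sup>3)\<close>, and quadratic growth absorbs the cubic term into half of the gap.
  Because the Lagrangian lives on the whole space, these expansions may run along a straight segment,
  although the segment may leave the feasible set.

  The two cases are the lemmas \<open>infeasible_point_estimates\<close> and \<open>feasible_point_estimate\<close>; the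
  multiplier comes from \<open>lagrange_multiplier\<close>, the singular value bound from
  \<open>sigma_min_mult_norm_le\<close>. For regularity, at a feasible point quadratic growth turns the gap bound into one on \<open>r\<close>; at an
  infeasible point \<open>\<parallel>w\<parallel> \<ge> L\<close> already suffices once \<open>r \<le> 8 L / \<alpha>\<close>.
\<close>

section \<open>Derivatives and remainder estimates along a segment\<close>

lemma deriv1_has_derivative:
  assumes "g differentiable (at x)"
  shows "(g has_derivative blinfun_apply (deriv1 g x)) (at x)"
proof -
  have "(g has_derivative frechet_derivative g (at x)) (at x)"
    using assms frechet_derivative_works by blast
  then show ?thesis
    by (simp add: deriv1_def bounded_linear_Blinfun_apply has_derivative_bounded_linear)
qed

lemma lipschitz_has_derivative_bound:
  fixes g :: "'a::real_normed_vector \<Rightarrow> 'b::real_normed_vector"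
  assumes lip: "L-lipschitz_on X g" and x: "x \<in> interior X"
    and der: "(g has_derivative g') (at x)"
  shows "norm (g' h) \<le> L * norm h"
proof -
  have "((\<lambda>t. g (x + t *\<^sub>R h)) has_vector_derivative g' h) (at 0)"
  proof -
    have "(g has_derivative g') (at (x + 0 *\<^sub>R h))"
      using der by simp
    then have "((\<lambda>t. g (x + t *\<^sub>R h)) has_derivative (\<lambda>t. g' (t *\<^sub>R h))) (at 0)"
      by (rule has_derivative_compose[rotated]) (auto intro!: derivative_eq_intros)
    moreover have "linear g'" using der by (rule has_derivative_linear)
    ultimately show ?thesis
      by (simp add: has_vector_derivative_def linear_cmul)
  qed
  then have "((\<lambda>t. norm (g (x + t *\<^sub>R h) - g x - t *\<^sub>R g' h) / norm t) \<longlongrightarrow> 0) (at 0)"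
    by (simp add: has_vector_derivative_def has_derivative_at)
  then have "((\<lambda>t. norm ((g (x + t *\<^sub>R h) - g x) /\<^sub>R t - g' h)) \<longlongrightarrow> 0) (at 0)"
  proof (rule Lim_transform_eventually)
    show "\<forall>\<^sub>F t in at 0. norm (g (x + t *\<^sub>R h) - g x - t *\<^sub>R g' h) / norm t
        = norm ((g (x + t *\<^sub>R h) - g x) /\<^sub>R t - g' h)"
      using eventually_neq_at_within[of 0 0 UNIV]
    proof eventually_elim
      case (elim t)
      then have "(g (x + t *\<^sub>R h) - g x) /\<^sub>R t - g' h
          = (g (x + t *\<^sub>R h) - g x - t *\<^sub>R g' h) /\<^sub>R t"
        by (simp add: scaleR_diff_right)
      then show ?case by (simp add: divide_inverse_commute)
    qed
  qed
  then have "((\<lambda>t. (g (x + t *\<^sub>R h) - g x) /\<^sub>R t) \<longlongrightarrow> g' h) (at 0)"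
    by (rule LIM_zero_cancel[OF tendsto_norm_zero_cancel])
  then have lim: "((\<lambda>t. norm ((g (x + t *\<^sub>R h) - g x) /\<^sub>R t)) \<longlongrightarrow> norm (g' h)) (at 0)"
    by (rule tendsto_norm)
  have "((\<lambda>t. x + t *\<^sub>R h) \<longlongrightarrow> x + 0 *\<^sub>R h) (at 0)"
    by (intro tendsto_intros)
  then have "\<forall>\<^sub>F t in at 0. x + t *\<^sub>R h \<in> interior X"
    using topological_tendstoD[OF _ open_interior, of _ _ _ X] x by simp
  then have "\<forall>\<^sub>F t in at 0. norm ((g (x + t *\<^sub>R h) - g x) /\<^sub>R t) \<le> L * norm h"
    using eventually_neq_at_within[of 0 0 UNIV]
  proof eventually_elim
    case (elim t)
    have "norm (g (x + t *\<^sub>R h) - g x) \<le> L * norm ((x + t *\<^sub>R h) - x)"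
      using lipschitz_on_normD[OF lip] elim x interior_subset by blast
    moreover have "norm ((g (x + t *\<^sub>R h) - g x) /\<^sub>R t) = norm (g (x + t *\<^sub>R h) - g x) / \<bar>t\<bar>"
      by (simp add: divide_inverse_commute)
    ultimately show ?case using elim by (simp add: pos_divide_le_eq mult_ac)
  qed
  then show ?thesis
    using tendsto_upperbound[OF lim] trivial_limit_at[of "0::real"] by simp
qed

text \<open>Expanding at the far end \<open>y\<close> suits the use below: there the subgradient sits at the point \<open>y\<close>
  under study and \<open>x\<close> is its nearest solution.\<close>

lemma first_order_remainder:
  fixes g :: "'a::real_normed_vector \<Rightarrow> 'b::real_normed_vector" and g' :: "'a \<Rightarrow> 'a \<Rightarrow>\<^sub>L 'b"
  assumes der: "\<And>u. u \<in> closed_segment x y \<Longrightarrow> (g has_derivative blinfun_apply (g' u)) (at u)"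
    and lip: "K-lipschitz_on (closed_segment x y) g'"
  shows "norm (g y - g x - g' y (y - x)) \<le> K * (norm (y - x))\<^sup>2"
proof -
  have K: "0 \<le> K" using lip by (rule lipschitz_on_nonneg)
  have "norm (g y - g x - g' y (y - x)) \<le> norm (y - x) * (K * norm (y - x))"
  proof (rule differentiable_bound_linearization[where S = "closed_segment x y" and f = g
        and a = x and b = y and f' = "\<lambda>u. blinfun_apply (g' u)" and ?x0.0 = y])
    show "x + t *\<^sub>R (y - x) \<in> closed_segment x y" if "t \<in> {0..1}" for t
      unfolding in_segment by (rule exI[of _ t]) (use that in \<open>auto simp: algebra_simps\<close>)
    show "(g has_derivative blinfun_apply (g' u)) (at u within closed_segment x y)"
      if "u \<in> closed_segment x y" for u
      using der[OF that] by (rule has_derivative_at_withinI)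
    show "onorm (blinfun_apply (g' u) - blinfun_apply (g' y)) \<le> K * norm (y - x)" if u: "u \<in> closed_segment x y" for u
    proof -
      have "blinfun_apply (g' u) - blinfun_apply (g' y) = blinfun_apply (g' u - g' y)"
        by (simp add: fun_eq_iff blinfun.diff_left)
      then have "onorm (blinfun_apply (g' u) - blinfun_apply (g' y)) = norm (g' u - g' y)"
        by (simp add: norm_blinfun.rep_eq)
      also have "\<dots> \<le> K * norm (u - y)"
        using lipschitz_on_normD[OF lip u ends_in_segment(2)] .
      also have "\<dots> \<le> K * norm (y - x)"
        using segment_bound(2)[OF u] K by (rule mult_left_mono)
      finally show ?thesis .
    qed
  qed auto
  then show ?thesis by (simp add: power2_eq_square mult_ac)
qed

text \<open>The error of the trapezoid rule as a function of the right end \<open>t\<close> has derivative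
  \<open>(g' (u t) - g' x - t g'' (u t) d) d / 2\<close>, half of a first-order remainder of \<open>g'\<close>; a Lipschitz
  second derivative is enough to make it of third order.\<close>

lemma trapezoid_remainder:
  fixes g :: "'a::real_normed_vector \<Rightarrow> 'b::real_normed_vector"
    and g' :: "'a \<Rightarrow> 'a \<Rightarrow>\<^sub>L 'b" and g'' :: "'a \<Rightarrow> 'a \<Rightarrow>\<^sub>L 'a \<Rightarrow>\<^sub>L 'b"
  assumes der: "\<And>u. u \<in> closed_segment x y \<Longrightarrow> (g has_derivative blinfun_apply (g' u)) (at u)"
    and der2: "\<And>u. u \<in> closed_segment x y \<Longrightarrow> (g' has_derivative blinfun_apply (g'' u)) (at u)"
    and lip: "K-lipschitz_on (closed_segment x y) g''"
  shows "norm (g y - g x - (1/2) *\<^sub>R (g' x (y - x) + g' y (y - x))) \<le> K / 2 * norm (y - x) ^ 3"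
proof -
  define d where "d = y - x"
  define u where "u t = x + t *\<^sub>R d" for t
  define q where "q t = g' (u t) d" for t
  define E where "E t = g (u t) - g x - (t/2) *\<^sub>R (g' x d + q t)" for t
  define E' where "E' t = (1/2) *\<^sub>R ((g' (u t) - g' x - t *\<^sub>R g'' (u t) d) d)" for t
  have K: "0 \<le> K" using lip by (rule lipschitz_on_nonneg)
  have useg: "u t \<in> closed_segment x y" if "t \<in> {0..1}" for t
    unfolding in_segment by (rule exI[of _ t]) (use that in \<open>auto simp: u_def d_def algebra_simps\<close>)
  have du: "(u has_derivative (\<lambda>s. s *\<^sub>R d)) (at t)" for t
    unfolding u_def by (auto intro!: derivative_eq_intros)
  have "norm (E 1 - E 0) \<le> (K / 2 * norm d ^ 3) * norm (1 - 0 :: real)"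
  proof (rule differentiable_bound[where S = "{0..1}"])
    show "(E has_derivative (\<lambda>s. s *\<^sub>R E' t)) (at t within {0..1})" if t: "t \<in> {0..1}" for t
    proof -
      have "((\<lambda>t. g (u t)) has_derivative (\<lambda>s. g' (u t) (s *\<^sub>R d))) (at t)"
        using has_derivative_compose[OF du der[OF useg[OF t]]] .
      moreover have "((\<lambda>t. g' (u t)) has_derivative (\<lambda>s. g'' (u t) (s *\<^sub>R d))) (at t)"
        using has_derivative_compose[OF du der2[OF useg[OF t]]] .
      then have "(q has_derivative (\<lambda>s. g'' (u t) (s *\<^sub>R d) d)) (at t)"
        unfolding q_def by (rule bounded_linear.has_derivative[OF blinfun.bounded_linear_left])
      ultimately have "(E has_derivative (\<lambda>s. g' (u t) (s *\<^sub>R d)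
          - ((t/2) *\<^sub>R g'' (u t) (s *\<^sub>R d) d + (s/2) *\<^sub>R (g' x d + q t)))) (at t)"
        unfolding E_def by (auto intro!: derivative_eq_intros)
      moreover have "(\<lambda>s. g' (u t) (s *\<^sub>R d)
          - ((t/2) *\<^sub>R g'' (u t) (s *\<^sub>R d) d + (s/2) *\<^sub>R (g' x d + q t)))
          = (\<lambda>s. s *\<^sub>R E' t)"
      proof
        fix s
        have "g' (u t) (s *\<^sub>R d) = (s/2) *\<^sub>R q t + (s/2) *\<^sub>R q t"
          by (simp add: q_def blinfun.bilinear_simps flip: scaleR_add_left)
        then show "g' (u t) (s *\<^sub>R d)
          - ((t/2) *\<^sub>R g'' (u t) (s *\<^sub>R d) d + (s/2) *\<^sub>R (g' x d + q t)) = s *\<^sub>R E' t"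
          by (simp add: E'_def q_def blinfun.bilinear_simps algebra_simps)
      qed
      ultimately show ?thesis
        by (simp add: has_derivative_at_withinI)
    qed
    show "onorm (\<lambda>s. s *\<^sub>R E' t) \<le> K / 2 * norm d ^ 3" if t: "t \<in> {0..1}" for t
    proof (rule onorm_le)
      fix s :: real
      have seg: "closed_segment x (u t) \<subseteq> closed_segment x y"
        using useg[OF t] by (simp add: subset_closed_segment)
      have "norm (g' (u t) - g' x - g'' (u t) (u t - x)) \<le> K * (norm (u t - x))\<^sup>2"
        using seg by (intro first_order_remainder der2 lipschitz_on_subset[OF lip]) auto
      also have "\<dots> \<le> K * (norm d)\<^sup>2"
        using t K by (auto simp: u_def intro!: mult_left_mono power_mono mult_left_le_one_le)
      finally have "norm (g' (u t) - g' x - t *\<^sub>R g'' (u t) d) \<le> K * (norm d)\<^sup>2"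
        by (simp add: u_def blinfun.bilinear_simps)
      then have "norm ((g' (u t) - g' x - t *\<^sub>R g'' (u t) d) d) \<le> K * (norm d)\<^sup>2 * norm d"
        by (meson norm_blinfun mult_right_mono norm_ge_zero order_trans)
      then have "norm (E' t) \<le> K / 2 * norm d ^ 3"
        by (simp add: E'_def power2_eq_square power3_eq_cube)
      then show "norm (s *\<^sub>R E' t) \<le> K / 2 * norm d ^ 3 * norm s"
        using mult_right_mono[OF _ abs_ge_zero[of s]] by (metis mult.commute norm_scaleR real_norm_def)
    qed
  qed auto
  then show ?thesis
    by (simp add: E_def q_def u_def d_def)
qed

lemma smooth_withD:
  assumes "smooth_with L \<beta> \<rho> X g"
  shows "x \<in> X \<Longrightarrow> (g has_derivative blinfun_apply (deriv1 g x)) (at x)"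
    and "x \<in> X \<Longrightarrow> (deriv1 g has_derivative blinfun_apply (deriv2 g x)) (at x)"
    and "x \<in> X \<Longrightarrow> norm (deriv2 g x) \<le> \<beta>"
    and "\<rho>-lipschitz_on X (deriv2 g)" and "L-lipschitz_on X g"
  using assms deriv1_has_derivative[of g x] deriv1_has_derivative[of "deriv1 g" x]
  unfolding smooth_with_def C2_on_def deriv2_def by blast+

lemma closed_segment_subset_nbhd:
  fixes x y :: "'a::real_normed_vector"
  assumes "y \<in> S" and "dist x y \<le> e"
  shows "closed_segment y x \<subseteq> nbhd S e"
proof
  fix u assume "u \<in> closed_segment y x"
  then have "dist u y \<le> dist x y"
    using segment_bound1[of u y x] by (simp add: dist_norm)
  then show "u \<in> nbhd S e"
    using infdist_le2[OF assms(1), of u e] assms(2) by (simp add: nbhd_def)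
qed

section \<open>Lagrange multipliers\<close>

text \<open>If no multiplier existed, the derivative of \<open>(p, F)\<close> would be onto. Then, by Sussmann's open
  mapping theorem, \<open>(p, F)\<close> would take the value \<open>(p x - e/2, F x)\<close> near \<open>x\<close>, against minimality.
  Differentiability at the single point \<open>x\<close> and continuity nearby replace the implicit function
  theorem here.\<close>

lemma lagrange_multiplier:
  fixes p :: "'a::euclidean_space \<Rightarrow> real" and F :: "'a \<Rightarrow> 'b::euclidean_space"
  assumes U: "open U" "x \<in> U" and cont: "continuous_on U p" "continuous_on U F"
    and dp: "(p has_derivative p') (at x)" and dF: "(F has_derivative F') (at x)"
    and surj: "surj F'"
    and min: "\<And>y. y \<in> U \<Longrightarrow> F y = F x \<Longrightarrow> p x \<le> p y"
  obtains z where "\<And>e. p' e + z \<bullet> F' e = 0"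
proof -
  define G where "G y = (p y, F y)" for y
  define G' where "G' e = (p' e, F' e)" for e
  have dG: "(G has_derivative G') (at x)"
    unfolding G_def[abs_def] G'_def[abs_def] using dp dF by (rule has_derivative_Pair)
  then have lin: "linear G'" by (rule has_derivative_linear)
  have "\<not> surj G'"
  proof
    assume "surj G'"
    then obtain h where h: "linear h" "G' \<circ> h = id"
      using linear_surjective_right_inverse[OF lin] by blast
    have "G x \<in> interior (G ` U)"
    proof (rule sussmann_open_mapping[OF U(1) _ U(2) dG _ h(2)])
      show "continuous_on U G" unfolding G_def[abs_def] by (intro continuous_intros cont)
      show "bounded_linear h" using h(1) by (simp add: linear_linear)
      show "x \<in> interior U" using U by (simp add: interior_open)
    qed simp
    then obtain e where e: "0 < e" "ball (G x) e \<subseteq> G ` U"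
      by (meson mem_interior)
    have "(p x - e/2, F x) \<in> ball (G x) e"
      using e by (simp add: G_def dist_Pair_Pair dist_real_def)
    then obtain y where "y \<in> U" "p y = p x - e/2" "F y = F x"
      using e by (auto simp: G_def)
    then show False using min e(1) by force
  qed
  \<comment> \<open>A vector normal to the range of the derivative is a multiplier up to scaling.\<close>
  then have "span (range G') \<noteq> UNIV"
    using lin by (metis linear_span_image span_UNIV)
  then obtain a where a: "a \<noteq> 0" "span (range G') \<subseteq> {w. a \<bullet> w = 0}"
    using span_not_univ_subset_hyperplane by blast
  obtain s y where sy: "a = (s, y)" by (cases a)
  have ann: "s * p' e + y \<bullet> F' e = 0" for e
    using a(2) span_base[of "G' e" "range G'"] by (auto simp: sy G'_def)
  have "s \<noteq> 0"
  proof
    assume "s = 0"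
    moreover obtain e where "F' e = y" using surj by (metis surjD)
    ultimately show False using ann[of e] a(1) sy by (simp add: zero_prod_def)
  qed
  show ?thesis
  proof
    show "p' e + (y /\<^sub>R s) \<bullet> F' e = 0" for e
      using ann[of e] \<open>s \<noteq> 0\<close> by (simp add: field_simps)
  qed
qed

section \<open>The least singular value\<close>

text \<open>Finiteness is what makes \<open>sigma_min\<close> a lower bound of all singular values. Left singular vectors are
  eigenvectors of \<open>B B\<^sup>T\<close> for the eigenvalue \<open>s\<^sup>2\<close>, so those of distinct singular values are
  orthogonal.\<close>

lemma finite_singular_values:
  fixes B :: "real^'n^'k"
  shows "finite (singular_values B)"
proof -
  have "\<exists>u. norm u = 1 \<and> B *v (u v* B) = s\<^sup>2 *\<^sub>R u" if s: "s \<in> singular_values B" for s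
  proof -
    obtain u v where uv: "norm u = 1" "B *v v = s *\<^sub>R u" "u v* B = s *\<^sub>R v"
      using s by (auto simp: singular_values_def)
    then have "B *v (u v* B) = s\<^sup>2 *\<^sub>R u"
      by (simp add: matrix_vector_mult_scaleR power2_eq_square)
    with uv(1) show ?thesis by blast
  qed
  then obtain U where U: "\<And>s. s \<in> singular_values B \<Longrightarrow> norm (U s) = 1"
      "\<And>s. s \<in> singular_values B \<Longrightarrow> B *v (U s v* B) = s\<^sup>2 *\<^sub>R U s"
    by metis
  have orth: "U s \<bullet> U t = 0" if s: "s \<in> singular_values B" and t: "t \<in> singular_values B" and "s \<noteq> t" for s t
  proof -
    have "s\<^sup>2 * (U s \<bullet> U t) = (B *v (U s v* B)) \<bullet> U t" using U(2)[OF s] by simp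
    also have "\<dots> = (U s v* B) \<bullet> (U t v* B)" by (metis dot_lmul_matrix inner_commute)
    also have "\<dots> = U s \<bullet> (B *v (U t v* B))" by (simp add: dot_lmul_matrix)
    also have "\<dots> = t\<^sup>2 * (U s \<bullet> U t)" using U(2)[OF t] by simp
    finally have "U s \<bullet> U t = 0 \<or> s\<^sup>2 = t\<^sup>2" by simp
    moreover have "0 \<le> s" "0 \<le> t" using s t by (auto simp: singular_values_def)
    ultimately show ?thesis using \<open>s \<noteq> t\<close> by (auto simp: power2_eq_iff)
  qed
  have "inj_on U (singular_values B)"
  proof (rule inj_onI, rule ccontr)
    fix s t assume *: "s \<in> singular_values B" "t \<in> singular_values B" "U s = U t" "s \<noteq> t"
    then have "norm (U s) = 0" using orth by (metis inner_eq_zero_iff norm_zero)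
    then show False using U(1) * by simp
  qed
  moreover have "pairwise orthogonal (U ` singular_values B)"
    using orth by (auto simp: pairwise_def orthogonal_def)
  then have "finite (U ` singular_values B)" by (rule pairwise_orthogonal_imp_finite)
  ultimately show ?thesis using finite_imageD by blast
qed

text \<open>The minimum \<open>s\<close> of \<open>\<parallel>B\<^sup>T u\<parallel>\<close> over the unit sphere is attained, and it is a singular value:
  the minimizer is an eigenvector of \<open>B B\<^sup>T\<close>, and full row rank gives \<open>s > 0\<close>, so that
  \<open>B\<^sup>T u / s\<close> is a right singular vector. Hence the least singular value is at most \<open>s\<close>.\<close>

lemma sigma_min_mult_norm_le:
  fixes B :: "real^'n^'k"
  assumes rank: "rank B = CARD('k)"
  shows "sigma_min B * norm z \<le> norm (z v* B)"
proof -
  have lin: "linear (\<lambda>u. u v* B)"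
    using matrix_vector_mul_linear[of "transpose B"] by simp
  have inj: "u = 0" if "u v* B = 0" for u
  proof -
    obtain w where "u = B *v w"
      using rank full_rank_surjective by (metis surjD)
    then have "u \<bullet> u = (u v* B) \<bullet> w" by (simp add: dot_lmul_matrix)
    then show ?thesis using that by simp
  qed
  have "continuous_on (sphere 0 1) (\<lambda>u. norm (u v* B))"
    using lin by (intro continuous_on_norm linear_continuous_on) (simp add: linear_linear)
  moreover have "axis undefined 1 \<in> (sphere 0 1 :: (real^'k) set)" by simp
  ultimately obtain u where u: "norm u = 1"
      and least: "\<And>w. norm w = 1 \<Longrightarrow> norm (u v* B) \<le> norm (w v* B)"
    using continuous_attains_inf[of "sphere 0 1" "\<lambda>u. norm (u v* B)"] by fastforce
  define s where "s = norm (u v* B)"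
  have below: "s * norm w \<le> norm (w v* B)" for w
  proof (cases "w = 0")
    case False
    have "s \<le> norm ((w /\<^sub>R norm w) v* B)"
      unfolding s_def using False by (intro least) simp
    also have "(w /\<^sub>R norm w) v* B = (w v* B) /\<^sub>R norm w"
      using linear_cmul[OF lin] by simp
    finally show ?thesis using False by (simp add: field_simps)
  qed simp
  \<comment> \<open>The quadratic form of \<open>B B\<^sup>T - s\<^sup>2\<close> is nonnegative and vanishes at \<open>u\<close>; its derivative there in the direction of the residual \<open>r\<close> is \<open>2 (r \<bullet> r)\<close>.\<close>
  have eig: "B *v (u v* B) = s\<^sup>2 *\<^sub>R u"
  proof -
    define r where "r = B *v (u v* B) - s\<^sup>2 *\<^sub>R u"
    define a where "a = 2 * ((u v* B) \<bullet> (r v* B) - s\<^sup>2 * (u \<bullet> r))"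
    define k where "k = (norm (r v* B))\<^sup>2 - s\<^sup>2 * (norm r)\<^sup>2"
    have "0 \<le> a * t + k * t\<^sup>2" for t
    proof -
      have "(s * norm (u + t *\<^sub>R r))\<^sup>2 \<le> (norm ((u + t *\<^sub>R r) v* B))\<^sup>2"
        using below by (intro power_mono) (auto simp: s_def)
      moreover have "(u + t *\<^sub>R r) v* B = u v* B + t *\<^sub>R (r v* B)"
        using linear_add[OF lin] linear_cmul[OF lin] by simp
      moreover have "s\<^sup>2 * (norm (u + t *\<^sub>R r))\<^sup>2 = s\<^sup>2 + 2 * t * s\<^sup>2 * (u \<bullet> r) + t\<^sup>2 * (s\<^sup>2 * (norm r)\<^sup>2)"
      proof -
        have "u \<bullet> u = 1" using u by (simp add: norm_eq_1)
        then show ?thesis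
          unfolding power2_norm_eq_inner
          by (simp add: inner_simps inner_commute power2_eq_square algebra_simps)
      qed
      moreover have "(norm (u v* B + t *\<^sub>R (r v* B)))\<^sup>2
          = s\<^sup>2 + 2 * t * ((u v* B) \<bullet> (r v* B)) + t\<^sup>2 * (norm (r v* B))\<^sup>2"
        unfolding s_def power2_norm_eq_inner
        by (simp add: inner_simps inner_commute power2_eq_square algebra_simps)
      ultimately show ?thesis
        by (simp add: a_def k_def power_mult_distrib algebra_simps)
    qed
    moreover have "((\<lambda>t. a * t + k * t\<^sup>2) has_real_derivative a) (at 0)"
      by (auto intro!: derivative_eq_intros)
    ultimately have "a = 0"
      using DERIV_local_min[of "\<lambda>t. a * t + k * t\<^sup>2" a 0 1] by simp
    moreover have "(u v* B) \<bullet> (r v* B) = (B *v (u v* B)) \<bullet> r"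
      by (metis dot_lmul_matrix inner_commute)
    moreover have "r \<bullet> r = (B *v (u v* B)) \<bullet> r - s\<^sup>2 * (u \<bullet> r)"
      by (subst (1) r_def) (simp only: inner_diff_left inner_scaleR_left)
    ultimately have "r \<bullet> r = 0" by (simp add: a_def)
    then have "r = 0" by simp
    then show ?thesis by (simp add: r_def)
  qed
  have "s > 0"
    using inj[of u] u by (auto simp: s_def)
  have "s \<in> singular_values B"
    unfolding singular_values_def mem_Collect_eq
  proof (intro conjI exI)
    show "norm ((u v* B) /\<^sub>R s) = 1" using \<open>s > 0\<close> by (simp add: s_def)
    show "B *v ((u v* B) /\<^sub>R s) = s *\<^sub>R u"
      using eig \<open>s > 0\<close> by (simp add: matrix_vector_mult_scaleR power2_eq_square)
    show "transpose B *v u = s *\<^sub>R ((u v* B) /\<^sub>R s)" using \<open>s > 0\<close> by simp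
  qed (use u \<open>s > 0\<close> in auto)
  then have "sigma_min B \<le> s"
    unfolding sigma_min_def using finite_singular_values by (rule Min_le[rotated])
  then have "sigma_min B * norm z \<le> s * norm z" by (rule mult_right_mono) simp
  then show ?thesis using below[of z] by linarith
qed

section \<open>Subgradients of the penalized outer function\<close>

text \<open>Only the derivative along the line through \<open>y\<close> in direction \<open>e\<close> is needed. This matters at
  feasible points, where the penalized function need not be differentiable but is so along the kernel of \<open>A\<close>.\<close>

lemma subgradient_eq_directional_derivative:
  assumes v: "v \<in> subdifferential h y"
    and der: "((\<lambda>t. h (y + t *\<^sub>R e)) has_real_derivative D) (at 0)"
  shows "v \<bullet> e = D"
proof -
  have "((\<lambda>t. h (y + t *\<^sub>R e) - t * (v \<bullet> e)) has_real_derivative D - v \<bullet> e) (at 0)"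
    using der by (auto intro!: derivative_eq_intros)
  moreover have "h y \<le> h (y + t *\<^sub>R e) - t * (v \<bullet> e)" for t
  proof -
    have "h y + v \<bullet> (y + t *\<^sub>R e - y) \<le> h (y + t *\<^sub>R e)"
      using v unfolding subdifferential_def by blast
    then show ?thesis by simp
  qed
  ultimately have "D - v \<bullet> e = 0"
    using DERIV_local_min[of "\<lambda>t. h (y + t *\<^sub>R e) - t * (v \<bullet> e)" "D - v \<bullet> e" 0 1] by simp
  then show ?thesis by simp
qed

lemma has_derivative_directional:
  fixes h :: "'a::real_normed_vector \<Rightarrow> real"
  assumes "(h has_derivative h') (at y)"
  shows "((\<lambda>t. h (y + t *\<^sub>R e)) has_real_derivative h' e) (at 0)"
proof -
  have "(h has_derivative h') (at (y + 0 *\<^sub>R e))"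
    using assms by simp
  then have "((\<lambda>t. h (y + t *\<^sub>R e)) has_derivative (\<lambda>t. h' (t *\<^sub>R e))) (at 0)"
    by (rule has_derivative_compose[rotated]) (auto intro!: derivative_eq_intros)
  moreover have "linear h'" using assms by (rule has_derivative_linear)
  moreover have "(*) (h' e) = (\<lambda>t. t * h' e)" by (simp add: fun_eq_iff)
  ultimately show ?thesis
    by (simp add: has_field_derivative_def linear_cmul)
qed

lemma orthogonal_kernel_imp_row_space:
  fixes A :: "real^'m^'k"
  assumes "\<And>e. A *v e = 0 \<Longrightarrow> q \<bullet> e = 0"
  obtains z where "q = z v* A"
proof -
  let ?R = "range (\<lambda>z. z v* A)"
  have lin: "linear (\<lambda>z. z v* A)"
    using matrix_vector_mul_linear[of "transpose A"] by simp
  obtain r s where r: "r \<in> span ?R" and s: "\<And>w. w \<in> span ?R \<Longrightarrow> orthogonal s w" and q: "q = r + s"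
    using orthogonal_subspace_decomp_exists[of ?R q] by blast
  have "(A *v s) \<bullet> z = 0" for z
  proof -
    have "s \<bullet> (z v* A) = 0" using s[of "z v* A"] by (simp add: orthogonal_def span_base)
    then show ?thesis by (metis dot_lmul_matrix inner_commute)
  qed
  then have "A *v s = 0" by (metis inner_eq_zero_iff)
  then have "q \<bullet> s = 0" using assms by blast
  moreover have "r \<bullet> s = 0" using s[OF r] by (simp add: orthogonal_def inner_commute)
  ultimately have "s = 0" by (simp add: q inner_add_left)
  moreover have "r \<in> ?R"
    using r lin by (metis linear_span_image span_UNIV)
  ultimately show thesis using q that by auto
qed

text \<open>Along the kernel of \<open>A\<close> the penalty vanishes identically, so a subgradient agrees there with the
  derivative of \<open>f\<close>; the difference is orthogonal to the kernel, hence a combination of rows.\<close>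

lemma subdifferential_penalized_feasible:
  fixes A :: "real^'m^'k"
  assumes f': "(f has_derivative f') (at y)" and v: "v \<in> subdifferential (penalized f A b lam) y"
    and feas: "A *v y = b"
  obtains z where "\<And>e. v \<bullet> e = f' e + z \<bullet> (A *v e)"
proof -
  have lin: "linear f'" using f' by (rule has_derivative_linear)
  have "(v - adjoint f' 1) \<bullet> e = 0" if e: "A *v e = 0" for e
  proof -
    have "penalized f A b lam (y + t *\<^sub>R e) = f (y + t *\<^sub>R e)" for t
      using e feas by (simp add: penalized_def matrix_vector_right_distrib matrix_vector_mult_scaleR)
    then have "v \<bullet> e = f' e"
      using subgradient_eq_directional_derivative[OF v] has_derivative_directional[OF f'] by simp
    then show ?thesis using adjoint_clauses(2)[OF lin, of 1 e] by (simp add: inner_diff_left)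
  qed
  then obtain z where z: "v - adjoint f' 1 = z v* A"
    using orthogonal_kernel_imp_row_space by blast
  have "v \<bullet> e = f' e + z \<bullet> (A *v e)" for e
  proof -
    have "(v - adjoint f' 1) \<bullet> e = z \<bullet> (A *v e)" by (simp add: z dot_lmul_matrix)
    then show ?thesis using adjoint_clauses(2)[OF lin, of 1 e] by (simp add: inner_diff_left)
  qed
  then show thesis by (rule that)
qed

lemma subdifferential_penalized_infeasible:
  fixes A :: "real^'m^'k"
  assumes f': "(f has_derivative f') (at y)" and v: "v \<in> subdifferential (penalized f A b lam) y"
    and infeas: "A *v y \<noteq> b"
  shows "v \<bullet> e = f' e + lam * (sgn (A *v y - b) \<bullet> (A *v e))"
proof -
  have "((\<lambda>x. A *v x - b) has_derivative (\<lambda>e. A *v e)) (at y)"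
    by (auto intro!: derivative_eq_intros bounded_linear_imp_has_derivative)
  then have "((\<lambda>x. norm (A *v x - b)) has_derivative (\<lambda>e. (A *v e) \<bullet> sgn (A *v y - b))) (at y)"
    by (rule has_derivative_compose[OF _ has_derivative_norm]) (use infeas in simp)
  then have "(penalized f A b lam has_derivative
      (\<lambda>e. f' e + lam * ((A *v e) \<bullet> sgn (A *v y - b)))) (at y)"
    unfolding penalized_def[abs_def] by (intro has_derivative_add f' has_derivative_mult_right)
  then show ?thesis
    using subgradient_eq_directional_derivative[OF v has_derivative_directional]
    by (simp add: inner_commute)
qed

lemma convex_on_above_tangent:
  fixes f :: "'a::real_normed_vector \<Rightarrow> real"
  assumes "convex_on UNIV f" and "(f has_derivative f') (at y)"
  shows "f y + f' (w - y) \<le> f w"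
proof -
  define u where "u t = y + t *\<^sub>R (w - y)" for t
  have "convex_on UNIV (\<lambda>t. f (u t))"
  proof (rule convex_onI)
    fix t s1 s2 :: real assume t: "0 < t" "t < 1"
    have "u ((1 - t) *\<^sub>R s1 + t *\<^sub>R s2) = (1 - t) *\<^sub>R u s1 + t *\<^sub>R u s2"
      by (simp add: u_def algebra_simps)
    then show "f (u ((1 - t) *\<^sub>R s1 + t *\<^sub>R s2)) \<le> (1 - t) * f (u s1) + t * f (u s2)"
      using convex_onD[OF assms(1), of t "u s1" "u s2"] t by simp
  qed simp
  then have "f' (w - y) * (1 - 0) \<le> f (u 1) - f (u 0)"
    using has_derivative_directional[OF assms(2), of "w - y"]
    by (intro convex_on_imp_above_tangent[where A = UNIV]) (auto simp: u_def)
  then show ?thesis by (simp add: u_def)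
qed

text \<open>Since the distance to the empty set is zero by convention, lower bounds on all subgradients
  bound that distance only once a subgradient exists. The witness uses \<open>sgn 0 = 0\<close> at feasible points.\<close>

lemma subdifferential_penalized_nonempty:
  fixes A :: "real^'m^'k"
  assumes f: "convex_on UNIV f" and f': "(f has_derivative f') (at y)" and lam: "0 \<le> lam"
  shows "subdifferential (penalized f A b lam) y \<noteq> {}"
proof -
  define n where "n = sgn (A *v y - b)"
  have lin: "linear f'" using f' by (rule has_derivative_linear)
  have "adjoint f' 1 + lam *\<^sub>R (n v* A) \<in> subdifferential (penalized f A b lam) y"
    unfolding subdifferential_def mem_Collect_eq
  proof
    fix w
    have "(adjoint f' 1 + lam *\<^sub>R (n v* A)) \<bullet> (w - y) = f' (w - y) + lam * (n \<bullet> (A *v (w - y)))"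
      using adjoint_works[OF lin, of "w - y" 1]
      by (simp add: inner_add_left dot_lmul_matrix inner_commute[of "adjoint f' 1"])
    moreover have "norm (A *v y - b) + n \<bullet> (A *v (w - y)) \<le> norm (A *v w - b)"
    proof -
      have "A *v (w - y) = (A *v w - b) - (A *v y - b)"
        by (simp add: matrix_vector_mult_diff_distrib)
      moreover have "n \<bullet> (A *v w - b) \<le> norm n * norm (A *v w - b)" by (rule norm_cauchy_schwarz)
      moreover have "norm n * norm (A *v w - b) \<le> norm (A *v w - b)"
        by (simp add: n_def norm_sgn)
      moreover have "n \<bullet> (A *v y - b) = norm (A *v y - b)"
        by (cases "A *v y - b = 0") (simp_all add: n_def sgn_div_norm dot_square_norm power2_eq_square)
      ultimately show ?thesis by (simp add: inner_diff_right)
    qed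
    ultimately show "penalized f A b lam y + (adjoint f' 1 + lam *\<^sub>R (n v* A)) \<bullet> (w - y)
        \<le> penalized f A b lam w"
      using convex_on_above_tangent[OF f f', of w] lam
        mult_left_mono[of "norm (A *v y - b) + n \<bullet> (A *v (w - y))" "norm (A *v w - b)" lam]
      by (simp add: penalized_def algebra_simps)
  qed
  then show ?thesis by blast
qed

lemma nabla_inner:
  assumes "c differentiable (at x)"
  shows "(nabla c x *v v) \<bullet> e = v \<bullet> deriv1 c x e"
    and "transpose (nabla c x) *v e = deriv1 c x e"
proof -
  have "(c has_derivative (\<lambda>h. jacobian c (at x) *v h)) (at x)"
    using assms jacobian_works by blast
  then have *: "jacobian c (at x) *v e = deriv1 c x e" for e
    using deriv1_has_derivative[OF assms] has_derivative_unique by (metis (no_types))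
  then show "(nabla c x *v v) \<bullet> e = v \<bullet> deriv1 c x e"
    by (simp add: nabla_def dot_lmul_matrix)
  show "transpose (nabla c x) *v e = deriv1 c x e"
    by (simp add: nabla_def transpose_transpose * del: transpose_matrix_vector)
qed

section \<open>The two gap estimates\<close>

text \<open>Here \<open>g\<close> stands for the gradient of the objective at the point, \<open>J\<close> for the derivative of the
  constraint function, \<open>y\<close> for its value, \<open>d\<close> for the step from a nearest solution and \<open>\<delta>\<close> for the
  increase of the objective. The unit vector \<open>u\<close> makes the penalty part of \<open>w\<close> at least
  \<open>lam * \<gamma>\<close> long, which outweighs \<open>g\<close> and also the remainders, as these grow no faster than
  \<open>lam\<close>.\<close>

lemma infeasible_point_estimates:
  fixes g d w :: "'a::euclidean_space" and J :: "'a \<Rightarrow> 'b::euclidean_space" and y u :: 'b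
  assumes J: "linear J" and licq: "\<And>z. \<gamma> * norm z \<le> norm (adjoint J z)"
    and g: "norm g \<le> L" and lam: "2 * L \<le> lam * \<gamma>" "0 \<le> lam"
    and u: "u = sgn y" "y \<noteq> 0"
    and w: "w = g + lam *\<^sub>R adjoint J u"
    and obj: "\<bar>\<delta> - g \<bullet> d\<bar> \<le> \<beta> * (norm d)\<^sup>2"
    and con: "norm (y - J d) \<le> \<kappa> * (norm d)\<^sup>2"
    and small: "(\<beta> + lam * \<kappa>) * norm d \<le> lam * \<gamma> / 2"
  shows "lam * \<gamma> / 2 \<le> norm w" and "\<delta> + lam * norm y \<le> 2 * norm w * norm d"
proof -
  have nu: "norm u = 1" using u by (simp add: norm_sgn)
  have "lam * \<gamma> \<le> norm (lam *\<^sub>R adjoint J u)"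
    using licq[of u] lam(2) by (simp add: nu mult_left_mono)
  also have "\<dots> \<le> norm w + norm g"
    using norm_triangle_ineq4[of w g] by (simp add: w)
  finally show big: "lam * \<gamma> / 2 \<le> norm w" using g lam(1) by linarith
  have "norm y = u \<bullet> y"
    using u by (simp add: sgn_div_norm dot_square_norm power2_eq_square)
  also have "\<dots> = u \<bullet> J d + u \<bullet> (y - J d)" by (simp add: inner_diff_right)
  also have "u \<bullet> (y - J d) \<le> \<kappa> * (norm d)\<^sup>2"
    using norm_cauchy_schwarz[of u "y - J d"] con nu by simp
  finally have "lam * norm y \<le> lam * (u \<bullet> J d + \<kappa> * (norm d)\<^sup>2)"
    using lam(2) by (simp add: mult_left_mono)
  moreover have "w \<bullet> d = g \<bullet> d + lam * (u \<bullet> J d)"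
    using adjoint_clauses(2)[OF J] by (simp add: w inner_add_left)
  moreover have "w \<bullet> d \<le> norm w * norm d" by (rule norm_cauchy_schwarz)
  moreover have "(\<beta> + lam * \<kappa>) * norm d * norm d \<le> norm w * norm d"
    using small big by (intro mult_right_mono) auto
  moreover have "\<delta> - g \<bullet> d \<le> \<beta> * (norm d)\<^sup>2" using obj by linarith
  ultimately show "\<delta> + lam * norm y \<le> 2 * norm w * norm d"
    by (simp add: algebra_simps power2_eq_square)
qed

text \<open>The subscripts 0 and 1 refer to the nearest solution and to the feasible point. With
  \<open>v = g1 + J1\<^sup>T z0\<close>, the gradient of the Lagrangian at the feasible point, stationarity turns the
  trapezoid rules for objective and constraint into \<open>\<delta> = v \<bullet> d / 2 + O(r\<^sup>3)\<close>. Passing from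
  \<open>v\<close> to \<open>w\<close> costs \<open>(z0 - z) \<bullet> J1 d\<close>, the product of \<open>\<parallel>z0 - z\<parallel> \<le> (\<parallel>v\<parallel> + \<parallel>w\<parallel>) / \<gamma>\<close>
  and a term of order \<open>r\<^sup>2\<close>.\<close>

lemma feasible_point_estimate:
  fixes g0 g1 d w :: "'a::euclidean_space" and J0 J1 :: "'a \<Rightarrow> 'b::euclidean_space" and z z0 :: 'b
  assumes J: "linear J0" "linear J1" and \<gamma>: "0 < \<gamma>"
    and licq: "\<And>z. \<gamma> * norm z \<le> norm (adjoint J1 z)"
    and stat: "g0 + adjoint J0 z0 = 0" and z0: "norm z0 \<le> M"
    and w: "w = g1 + adjoint J1 z"
    and obj: "\<bar>\<delta> - (g0 \<bullet> d + g1 \<bullet> d) / 2\<bar> \<le> \<tau> * norm d ^ 3"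
    and con: "norm ((1/2) *\<^sub>R (J0 d + J1 d)) \<le> \<sigma> * norm d ^ 3"
    and tangent: "norm (J1 d) \<le> \<kappa> * (norm d)\<^sup>2"
    and g_lip: "norm (g1 - g0) \<le> \<beta> * norm d"
    and J_lip: "\<And>e. norm (J1 e - J0 e) \<le> \<kappa> * norm d * norm e"
    and growth: "\<alpha> / 2 * (norm d)\<^sup>2 \<le> \<delta>"
    and small1: "\<kappa> * norm d \<le> \<gamma>"
    and small2: "(\<tau> + M * \<sigma> + (\<beta> + M * \<kappa>) * \<kappa> / (2 * \<gamma>)) * norm d \<le> \<alpha> / 4"
  shows "\<delta> \<le> 2 * norm w * norm d"
proof (cases "d = 0")
  case True
  then show ?thesis using obj by simp
next
  case False
  define r where "r = norm d"
  define v where "v = g1 + adjoint J1 z0"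
  have r: "0 < r" using False by (simp add: r_def)
  have M: "0 \<le> M" using z0 norm_ge_zero order_trans by blast
  have \<kappa>: "0 \<le> \<kappa>"
    using order_trans[OF norm_ge_zero tangent] r by (simp add: r_def zero_le_mult_iff)
  have ad: "adjoint J1 z \<bullet> e = z \<bullet> J1 e" "adjoint J0 z \<bullet> e = z \<bullet> J0 e" for z e
    using adjoint_clauses(2) J by blast+
  have v_eq: "v \<bullet> e = (g1 - g0) \<bullet> e + z0 \<bullet> (J1 e - J0 e)" for e
  proof -
    have "(g0 + adjoint J0 z0) \<bullet> e = 0" by (simp add: stat)
    then show ?thesis by (simp add: v_def ad inner_simps)
  qed
  have v_norm: "norm v \<le> (\<beta> + M * \<kappa>) * r"
  proof -
    have "norm v * norm v = v \<bullet> v" by (simp add: dot_square_norm power2_eq_square)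
    also have "\<dots> \<le> norm (g1 - g0) * norm v + norm z0 * norm (J1 v - J0 v)"
      unfolding v_eq[of v] by (intro add_mono norm_cauchy_schwarz)
    also have "\<dots> \<le> \<beta> * r * norm v + M * (\<kappa> * r * norm v)"
      using g_lip J_lip[of v] z0 M order_trans[OF norm_ge_zero g_lip]
      by (intro add_mono mult_mono) (auto simp: r_def)
    finally have "norm v * norm v \<le> (\<beta> + M * \<kappa>) * r * norm v" by (simp add: algebra_simps)
    moreover have "0 \<le> (\<beta> + M * \<kappa>) * r"
      using order_trans[OF norm_ge_zero g_lip] M \<kappa> r by (simp add: r_def algebra_simps)
    ultimately show ?thesis
      by (cases "v = 0") (auto simp: mult_le_cancel_right)
  qed
  have z_diff: "norm (z0 - z) \<le> (norm w + (\<beta> + M * \<kappa>) * r) / \<gamma>"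
  proof -
    have "adjoint J1 (z0 - z) = v - w"
      using linear_diff[OF adjoint_linear[OF J(2)]] by (simp add: v_def w)
    then have "\<gamma> * norm (z0 - z) \<le> norm v + norm w"
      using licq[of "z0 - z"] norm_triangle_ineq4[of v w] by simp
    then show ?thesis using v_norm \<gamma> by (simp add: pos_le_divide_eq mult.commute)
  qed
  \<comment> \<open>\<open>Q\<close> is the trapezoid error of the constraint, weighted by the multiplier; \<open>T\<close> bounds the cost of passing from \<open>v\<close> to \<open>w\<close>.\<close>
  define Q where "Q = z0 \<bullet> ((1/2) *\<^sub>R (J0 d + J1 d))"
  define T where "T = (norm w + (\<beta> + M * \<kappa>) * r) / \<gamma> * (\<kappa> * r\<^sup>2)"
  have "\<delta> \<le> (g0 \<bullet> d + g1 \<bullet> d) / 2 + \<tau> * r ^ 3" using obj by (simp add: r_def abs_le_iff)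
  moreover have "(g0 \<bullet> d + g1 \<bullet> d) / 2 = v \<bullet> d / 2 - Q"
  proof -
    have "(g0 + adjoint J0 z0) \<bullet> d = 0" by (simp add: stat)
    then show ?thesis by (simp add: v_def Q_def ad inner_simps field_simps)
  qed
  moreover have "- Q \<le> M * (\<sigma> * r ^ 3)"
  proof -
    have "\<bar>Q\<bar> \<le> norm z0 * norm ((1/2) *\<^sub>R (J0 d + J1 d))"
      unfolding Q_def by (rule Cauchy_Schwarz_ineq2)
    also have "\<dots> \<le> M * (\<sigma> * r ^ 3)"
      unfolding r_def by (rule mult_mono[OF z0 con M norm_ge_zero])
    finally show ?thesis by linarith
  qed
  moreover have "v \<bullet> d \<le> norm w * r + T"
  proof -
    have "v \<bullet> d = w \<bullet> d + (z0 - z) \<bullet> J1 d" by (simp add: v_def w ad inner_simps)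
    also have "\<dots> \<le> norm w * r + norm (z0 - z) * norm (J1 d)"
      unfolding r_def by (intro add_mono norm_cauchy_schwarz)
    also have "norm (z0 - z) * norm (J1 d) \<le> T"
      using order_trans[OF norm_ge_zero z_diff]
      unfolding T_def by (intro mult_mono z_diff tangent[folded r_def]) auto
    finally show ?thesis by simp
  qed
  ultimately have "\<delta> \<le> (norm w * r + T) / 2 + M * (\<sigma> * r ^ 3) + \<tau> * r ^ 3"
    by argo
  also have "\<dots> = norm w * r / 2 + (\<kappa> * r / \<gamma>) * (norm w * r / 2)
      + (\<tau> + M * \<sigma> + (\<beta> + M * \<kappa>) * \<kappa> / (2 * \<gamma>)) * r * r\<^sup>2"
    using \<gamma> by (simp add: T_def field_simps power2_eq_square power3_eq_cube)
  finally have "\<delta> \<le> norm w * r / 2 + (\<kappa> * r / \<gamma>) * (norm w * r / 2)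
      + (\<tau> + M * \<sigma> + (\<beta> + M * \<kappa>) * \<kappa> / (2 * \<gamma>)) * r * r\<^sup>2" .
  moreover have "(\<kappa> * r / \<gamma>) * (norm w * r / 2) \<le> 1 * (norm w * r / 2)"
    using small1 \<gamma> r by (intro mult_right_mono) (auto simp: r_def)
  moreover have "(\<tau> + M * \<sigma> + (\<beta> + M * \<kappa>) * \<kappa> / (2 * \<gamma>)) * r * r\<^sup>2 \<le> \<alpha> / 4 * r\<^sup>2"
    using small2 by (intro mult_right_mono) (auto simp: r_def)
  moreover have "\<alpha> / 4 * r\<^sup>2 \<le> \<delta> / 2" using growth by (simp add: r_def)
  ultimately have "\<delta> \<le> norm w * r + \<delta> / 2" by linarith
  then show ?thesis by (simp add: r_def)
qed

section \<open>The penalized problem near the solution set\<close>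

lemma norm_le_of_inner_le:
  fixes v :: "'a::real_inner"
  assumes "\<And>e. v \<bullet> e \<le> K * norm e" and "0 \<le> K"
  shows "norm v \<le> K"
proof (cases "v = 0")
  case False
  have "norm v * norm v \<le> K * norm v"
    using assms(1)[of v] by (simp add: dot_square_norm power2_eq_square)
  then show ?thesis using False by simp
qed (use assms in simp)

lemma le_infdist:
  assumes "X \<noteq> {}" and "\<And>a. a \<in> X \<Longrightarrow> r \<le> dist x a"
  shows "r \<le> infdist x X"
  using assms by (simp add: infdist_notempty cINF_greatest)

lemma eventually_at_right_0_mult_le:
  fixes K C :: real
  assumes "0 < C"
  shows "\<forall>\<^sub>F e in at_right 0. K * e \<le> C"
proof -
  have "((\<lambda>e. K * e) \<longlongrightarrow> K * 0) (at_right 0)" by (intro tendsto_intros)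
  then have "\<forall>\<^sub>F e in at_right 0. K * e < C"
    using assms by (intro order_tendstoD) auto
  then show ?thesis by eventually_elim simp
qed

text \<open>The assumptions under which the estimates hold, so that the constants they produce can be named
  once and shared.\<close>

locale penalized_problem =
  fixes c :: "real^'n \<Rightarrow> real^'m" and f :: "real^'m \<Rightarrow> real"
    and A :: "real^'m^'k" and b :: "real^'k" and S :: "(real^'n) set"
    and \<phi>\<^sub>s \<epsilon>\<^sub>0 \<alpha> \<gamma> L \<beta> \<rho> L\<^sub>c \<beta>\<^sub>c \<rho>\<^sub>c L\<^sub>f \<beta>\<^sub>f \<rho>\<^sub>f :: real
  assumes f_convex: "convex_on UNIV f"
    and eps0_pos: "0 < \<epsilon>\<^sub>0"
    and S_nonempty: "S \<noteq> {}" and S_compact: "compact S"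
    and S_feasible: "\<And>x. x \<in> S \<Longrightarrow> A *v c x = b"
    and S_value: "\<And>x. x \<in> S \<Longrightarrow> f (c x) = \<phi>\<^sub>s"
    and L_pos: "0 < L"
    and obj_smooth: "smooth_with L \<beta> \<rho> (nbhd S \<epsilon>\<^sub>0) (f \<circ> c)"
    and c_smooth: "smooth_with L\<^sub>c \<beta>\<^sub>c \<rho>\<^sub>c (nbhd S \<epsilon>\<^sub>0) c"
    and c_deriv_lipschitz: "\<beta>\<^sub>c-lipschitz_on (nbhd S \<epsilon>\<^sub>0) (deriv1 c)"
    and f_smooth: "smooth_with L\<^sub>f \<beta>\<^sub>f \<rho>\<^sub>f (c ` nbhd S \<epsilon>\<^sub>0) f"
    and alpha_pos: "0 < \<alpha>"
    and quadratic_growth: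
      "\<And>x. x \<in> nbhd S \<epsilon>\<^sub>0 \<Longrightarrow> A *v c x = b \<Longrightarrow> \<phi>\<^sub>s + \<alpha> / 2 * (infdist x S)\<^sup>2 \<le> f (c x)"
    and gamma_pos: "0 < \<gamma>"
    and full_row_rank:
      "\<And>x. x \<in> nbhd S \<epsilon>\<^sub>0 \<Longrightarrow> rank (A ** transpose (nabla c x)) = CARD('k)"
    and sigma_min_bound:
      "\<And>x. x \<in> nbhd S \<epsilon>\<^sub>0 \<Longrightarrow> \<gamma> \<le> sigma_min (A ** transpose (nabla c x))"
begin

text \<open>The adjoint of a linear functional applied to \<open>1\<close> is its representing vector.\<close>

definition grad :: "real^'n \<Rightarrow> real^'n" where
  "grad x = adjoint (blinfun_apply (deriv1 (f \<circ> c) x)) 1"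

definition J :: "real^'n \<Rightarrow> real^'n \<Rightarrow> real^'k" where
  "J x e = A *v deriv1 c x e"

lemma S_subset_nbhd: "x \<in> S \<Longrightarrow> x \<in> nbhd S \<epsilon>\<^sub>0"
  using eps0_pos by (simp add: nbhd_def)

lemma open_inner_nbhd: "open {x. infdist x S < \<epsilon>\<^sub>0}"
  by (intro open_Collect_less continuous_intros)

lemma interior_nbhd: "infdist x S < \<epsilon>\<^sub>0 \<Longrightarrow> x \<in> interior (nbhd S \<epsilon>\<^sub>0)"
  by (rule interiorI[OF open_inner_nbhd]) (auto simp: nbhd_def)

lemma grad_inner: "grad x \<bullet> e = deriv1 (f \<circ> c) x e"
  unfolding grad_def
  by (simp add: adjoint_clauses(2)[OF bounded_linear.linear[OF blinfun.bounded_linear_right]])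

lemma linear_J: "linear (J x)"
  unfolding J_def[abs_def]
  using linear_compose[OF bounded_linear.linear[OF blinfun.bounded_linear_right]
      matrix_vector_mul_linear] by (simp add: o_def)

lemma c_differentiable: "x \<in> nbhd S \<epsilon>\<^sub>0 \<Longrightarrow> c differentiable (at x)"
  using smooth_withD(1)[OF c_smooth] differentiableI by blast

lemma J_matrix: "x \<in> nbhd S \<epsilon>\<^sub>0 \<Longrightarrow> J x = (*v) (A ** transpose (nabla c x))"
  using nabla_inner(2)[OF c_differentiable]
  by (auto simp: J_def fun_eq_iff simp flip: matrix_vector_mul_assoc)

lemma surj_J: "x \<in> nbhd S \<epsilon>\<^sub>0 \<Longrightarrow> surj (J x)"
  using full_row_rank full_rank_surjective J_matrix by metis

lemma constraint_qualification:
  assumes "x \<in> nbhd S \<epsilon>\<^sub>0"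
  shows "\<gamma> * norm z \<le> norm (adjoint (J x) z)"
proof -
  have "\<gamma> * norm z \<le> sigma_min (A ** transpose (nabla c x)) * norm z"
    using sigma_min_bound[OF assms] by (rule mult_right_mono) simp
  also have "\<dots> \<le> norm (z v* (A ** transpose (nabla c x)))"
    using full_row_rank[OF assms] by (rule sigma_min_mult_norm_le)
  finally show ?thesis by (simp add: J_matrix[OF assms] adjoint_matrix)
qed

lemma norm_grad_le:
  assumes "infdist x S < \<epsilon>\<^sub>0"
  shows "norm (grad x) \<le> L"
proof (rule norm_le_of_inner_le)
  fix e
  have "x \<in> nbhd S \<epsilon>\<^sub>0" using assms by (simp add: nbhd_def)
  then have "norm (deriv1 (f \<circ> c) x e) \<le> L * norm e"
    using lipschitz_has_derivative_bound[OF smooth_withD(5)[OF obj_smooth] interior_nbhd[OF assms]]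
      smooth_withD(1)[OF obj_smooth] by blast
  then show "grad x \<bullet> e \<le> L * norm e" by (simp add: grad_inner)
qed (use L_pos in simp)

text \<open>Quadratic growth makes a point of \<open>S\<close> a local minimizer on the feasible set. The bound on the
  multiplier, which makes all later constants uniform over \<open>S\<close>, comes from the constraint
  qualification.\<close>

lemma multiplier_exists:
  assumes "x \<in> S"
  obtains z where "grad x + adjoint (J x) z = 0" and "norm z \<le> L / \<gamma>"
proof -
  let ?U = "{x. infdist x S < \<epsilon>\<^sub>0}"
  have U: "?U \<subseteq> nbhd S \<epsilon>\<^sub>0" "x \<in> ?U" and x: "x \<in> nbhd S \<epsilon>\<^sub>0"
    using assms eps0_pos by (auto simp: nbhd_def)
  have dc: "(c has_derivative blinfun_apply (deriv1 c x)) (at x)" if "x \<in> nbhd S \<epsilon>\<^sub>0" for x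
    using smooth_withD(1)[OF c_smooth that] .
  have cont: "continuous_on ?U (f \<circ> c)" "continuous_on ?U c"
    using lipschitz_on_continuous_on[OF smooth_withD(5)[OF obj_smooth]]
      lipschitz_on_continuous_on[OF smooth_withD(5)[OF c_smooth]] U(1)
    by (blast intro: continuous_on_subset)+
  obtain z where z: "\<And>e. deriv1 (f \<circ> c) x e + z \<bullet> J x e = 0"
  proof (rule lagrange_multiplier[where p = "f \<circ> c" and F = "\<lambda>x. A *v c x" and x = x and F' = "J x"])
    show "open ?U" by (rule open_inner_nbhd)
    show "continuous_on ?U (\<lambda>x. A *v c x)" 
      by (rule bounded_linear.continuous_on[OF matrix_vector_mul_bounded_linear cont(2)])
    show "((\<lambda>x. A *v c x) has_derivative J x) (at x)"
      unfolding J_def[abs_def]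
      by (rule bounded_linear.has_derivative[OF matrix_vector_mul_bounded_linear dc[OF x]])
    show "surj (J x)" using x by (rule surj_J)
    show "(f \<circ> c) x \<le> (f \<circ> c) y" if "y \<in> ?U" "A *v c y = A *v c x" for y
    proof -
      have "\<phi>\<^sub>s + \<alpha> / 2 * (infdist y S)\<^sup>2 \<le> f (c y)"
        using that U(1) S_feasible[OF assms] by (intro quadratic_growth) auto
      moreover have "0 \<le> \<alpha> / 2 * (infdist y S)\<^sup>2" using alpha_pos by simp
      ultimately show ?thesis using S_value[OF assms] by simp
    qed
  qed (use U(2) cont(1) smooth_withD(1)[OF obj_smooth x] in auto)
  have "(grad x + adjoint (J x) z) \<bullet> e = 0" for e
    using z[of e] adjoint_clauses(2)[OF linear_J] by (simp add: inner_add_left grad_inner)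
  then have eq: "grad x + adjoint (J x) z = 0" using inner_eq_zero_iff by blast
  then have "norm (adjoint (J x) z) = norm (grad x)"
    by (metis add_eq_0_iff norm_minus_cancel)
  then have "\<gamma> * norm z \<le> L"
    using constraint_qualification[OF x, of z] norm_grad_le[of x] U(2) by simp
  then have "norm z \<le> L / \<gamma>" using gamma_pos by (simp add: pos_le_divide_eq mult.commute)
  with eq show thesis by (rule that)
qed

lemma f_derivative:
  assumes "x \<in> nbhd S \<epsilon>\<^sub>0"
  shows "(f has_derivative blinfun_apply (deriv1 f (c x))) (at (c x))"
    and "deriv1 f (c x) (deriv1 c x e) = grad x \<bullet> e"
proof -
  show df: "(f has_derivative blinfun_apply (deriv1 f (c x))) (at (c x))"
    using smooth_withD(1)[OF f_smooth] assms by blast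
  have "((f \<circ> c) has_derivative (\<lambda>e. deriv1 f (c x) (deriv1 c x e))) (at x)"
    using has_derivative_compose[OF smooth_withD(1)[OF c_smooth assms] df] by (simp add: o_def)
  then show "deriv1 f (c x) (deriv1 c x e) = grad x \<bullet> e"
    using has_derivative_unique[OF smooth_withD(1)[OF obj_smooth assms]]
    by (simp add: grad_inner)
qed

lemma subgradient_feasible:
  assumes x: "x \<in> nbhd S \<epsilon>\<^sub>0" "A *v c x = b"
    and w: "w \<in> composite_subdifferential (penalized f A b lam) c x"
  obtains z where "w = grad x + adjoint (J x) z"
proof -
  obtain v where v: "v \<in> subdifferential (penalized f A b lam) (c x)" "w = nabla c x *v v"
    using w by (auto simp: composite_subdifferential_def)
  obtain z where z: "\<And>e. v \<bullet> e = deriv1 f (c x) e + z \<bullet> (A *v e)"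
    using subdifferential_penalized_feasible[OF f_derivative(1)[OF x(1)] v(1) x(2)] by blast
  have "w \<bullet> e = (grad x + adjoint (J x) z) \<bullet> e" for e
    using adjoint_clauses(2)[OF linear_J, of x z e]
    by (simp add: v(2) nabla_inner(1)[OF c_differentiable[OF x(1)]] z f_derivative(2)[OF x(1)]
        inner_add_left J_def)
  then have "w = grad x + adjoint (J x) z" by (subst vector_eq_rdot[symmetric]) blast
  then show thesis by (rule that)
qed

lemma subgradient_infeasible:
  assumes x: "x \<in> nbhd S \<epsilon>\<^sub>0" "A *v c x \<noteq> b"
    and w: "w \<in> composite_subdifferential (penalized f A b lam) c x"
  shows "w = grad x + lam *\<^sub>R adjoint (J x) (sgn (A *v c x - b))"
proof -
  obtain v where v: "v \<in> subdifferential (penalized f A b lam) (c x)" "w = nabla c x *v v"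
    using w by (auto simp: composite_subdifferential_def)
  have "w \<bullet> e = (grad x + lam *\<^sub>R adjoint (J x) (sgn (A *v c x - b))) \<bullet> e" for e
    using adjoint_clauses(2)[OF linear_J, of x "sgn (A *v c x - b)" e]
      subdifferential_penalized_infeasible[OF f_derivative(1)[OF x(1)] v(1) x(2)]
    by (simp add: v(2) nabla_inner(1)[OF c_differentiable[OF x(1)]] f_derivative(2)[OF x(1)]
        inner_add_left J_def)
  then show ?thesis by (subst vector_eq_rdot[symmetric]) blast
qed

lemma composite_subdifferential_nonempty:
  assumes "x \<in> nbhd S \<epsilon>\<^sub>0" and "0 \<le> lam"
  shows "composite_subdifferential (penalized f A b lam) c x \<noteq> {}"
  using subdifferential_penalized_nonempty[OF f_convex f_derivative(1)] assms
  unfolding composite_subdifferential_def by blast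

abbreviation norm_A :: real where "norm_A \<equiv> onorm ((*v) A)"

text \<open>A Lipschitz constant for the derivative of the constraint function.\<close>

abbreviation \<kappa> :: real where "\<kappa> \<equiv> norm_A * \<beta>\<^sub>c"

lemma norm_A_le: "norm (A *v y) \<le> norm_A * norm y"
  by (rule onorm[OF matrix_vector_mul_bounded_linear])

lemma constants_nonneg: "0 \<le> norm_A" "0 \<le> \<beta>" "0 \<le> \<rho>" "0 \<le> \<beta>\<^sub>c" "0 \<le> \<rho>\<^sub>c" "0 \<le> \<kappa>"
proof -
  obtain x where "x \<in> S" using S_nonempty by blast
  then show "0 \<le> \<beta>"
    using smooth_withD(3)[OF obj_smooth S_subset_nbhd] norm_ge_zero order_trans by blast
  show "0 \<le> norm_A" by (rule onorm_pos_le[OF matrix_vector_mul_bounded_linear])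
  show "0 \<le> \<rho>" "0 \<le> \<beta>\<^sub>c" "0 \<le> \<rho>\<^sub>c"
    using smooth_withD(4)[OF obj_smooth] c_deriv_lipschitz smooth_withD(4)[OF c_smooth]
      lipschitz_on_nonneg by blast+
  then show "0 \<le> \<kappa>" using \<open>0 \<le> norm_A\<close> by simp
qed

text \<open>The segment from \<open>xs\<close> to \<open>x\<close> stays in the neighbourhood where the smoothness bounds hold,
  because none of its points is farther from \<open>xs\<close> than \<open>x\<close> is.\<close>

lemma taylor_estimates:
  assumes xs: "xs \<in> S" and near: "dist x xs \<le> \<epsilon>\<^sub>0"
  defines "d \<equiv> x - xs"
  shows "\<bar>f (c x) - \<phi>\<^sub>s - grad x \<bullet> d\<bar> \<le> \<beta> * (norm d)\<^sup>2"
    and "norm ((A *v c x - b) - J x d) \<le> \<kappa> * (norm d)\<^sup>2"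
    and "\<bar>f (c x) - \<phi>\<^sub>s - (grad xs \<bullet> d + grad x \<bullet> d) / 2\<bar> \<le> \<rho> / 2 * norm d ^ 3"
    and "norm ((A *v c x - b) - (1/2) *\<^sub>R (J xs d + J x d)) \<le> norm_A * \<rho>\<^sub>c / 2 * norm d ^ 3"
    and "norm (grad x - grad xs) \<le> \<beta> * norm d"
    and "norm (J x e - J xs e) \<le> \<kappa> * norm d * norm e"
proof -
  let ?I = "closed_segment xs x"
  have I: "?I \<subseteq> nbhd S \<epsilon>\<^sub>0" using xs near by (rule closed_segment_subset_nbhd)
  have ends: "xs \<in> ?I" "x \<in> ?I" by auto
  have dp: "(f \<circ> c has_derivative blinfun_apply (deriv1 (f \<circ> c) u)) (at u)"
    and dp2: "(deriv1 (f \<circ> c) has_derivative blinfun_apply (deriv2 (f \<circ> c) u)) (at u)"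
    and dc: "(c has_derivative blinfun_apply (deriv1 c u)) (at u)"
    and dc2: "(deriv1 c has_derivative blinfun_apply (deriv2 c u)) (at u)" if "u \<in> ?I" for u
    using that I smooth_withD(1,2)[OF obj_smooth] smooth_withD(1,2)[OF c_smooth] by blast+
  have lip_p: "\<beta>-lipschitz_on ?I (deriv1 (f \<circ> c))"
  proof (rule bounded_derivative_imp_lipschitz)
    show "onorm (blinfun_apply (deriv2 (f \<circ> c) u)) \<le> \<beta>" if "u \<in> ?I" for u
      using smooth_withD(3)[OF obj_smooth] that I by (auto simp: norm_blinfun.rep_eq)
    show "(deriv1 (f \<circ> c) has_derivative blinfun_apply (deriv2 (f \<circ> c) u)) (at u within ?I)"
      if "u \<in> ?I" for u
      using dp2[OF that] by (rule has_derivative_at_withinI)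
  qed (use constants_nonneg in auto)
  have lip_c: "\<beta>\<^sub>c-lipschitz_on ?I (deriv1 c)"
    using lipschitz_on_subset[OF c_deriv_lipschitz I] .
  have lip_p2: "\<rho>-lipschitz_on ?I (deriv2 (f \<circ> c))" and lip_c2: "\<rho>\<^sub>c-lipschitz_on ?I (deriv2 c)"
    using lipschitz_on_subset[OF smooth_withD(4)[OF obj_smooth] I]
      lipschitz_on_subset[OF smooth_withD(4)[OF c_smooth] I] .
  have val: "f (c xs) = \<phi>\<^sub>s" "A *v c xs = b" using xs S_value S_feasible by auto
  show "\<bar>f (c x) - \<phi>\<^sub>s - grad x \<bullet> d\<bar> \<le> \<beta> * (norm d)\<^sup>2"
    using first_order_remainder[OF dp lip_p] by (simp add: val d_def grad_inner)
  show "\<bar>f (c x) - \<phi>\<^sub>s - (grad xs \<bullet> d + grad x \<bullet> d) / 2\<bar> \<le> \<rho> / 2 * norm d ^ 3"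
    using trapezoid_remainder[OF dp dp2 lip_p2] by (simp add: val d_def grad_inner)
  have "(A *v c x - b) - J x d = A *v (c x - c xs - deriv1 c x d)"
    by (simp add: val matrix_vector_mult_diff_distrib J_def)
  also have "norm \<dots> \<le> norm_A * (\<beta>\<^sub>c * (norm d)\<^sup>2)"
    using first_order_remainder[OF dc lip_c] constants_nonneg
    unfolding d_def by (intro order_trans[OF norm_A_le] mult_left_mono) auto
  finally show "norm ((A *v c x - b) - J x d) \<le> \<kappa> * (norm d)\<^sup>2" by simp
  have "(A *v c x - b) - (1/2) *\<^sub>R (J xs d + J x d)
      = A *v (c x - c xs - (1/2) *\<^sub>R (deriv1 c xs d + deriv1 c x d))"
    by (simp add: val matrix_vector_mult_diff_distrib matrix_vector_right_distrib
        matrix_vector_mult_scaleR scaleR_right_distrib J_def)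
  also have "norm \<dots> \<le> norm_A * (\<rho>\<^sub>c / 2 * norm d ^ 3)"
    using trapezoid_remainder[OF dc dc2 lip_c2] constants_nonneg
    unfolding d_def by (intro order_trans[OF norm_A_le] mult_left_mono) auto
  finally show "norm ((A *v c x - b) - (1/2) *\<^sub>R (J xs d + J x d)) \<le> norm_A * \<rho>\<^sub>c / 2 * norm d ^ 3"
    by simp
  show "norm (grad x - grad xs) \<le> \<beta> * norm d"
  proof (rule norm_le_of_inner_le)
    fix e
    have "(grad x - grad xs) \<bullet> e = (deriv1 (f \<circ> c) x - deriv1 (f \<circ> c) xs) e"
      by (simp add: inner_diff_left grad_inner blinfun.diff_left)
    also have "\<dots> \<le> norm (deriv1 (f \<circ> c) x - deriv1 (f \<circ> c) xs) * norm e"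
      using norm_blinfun[of "deriv1 (f \<circ> c) x - deriv1 (f \<circ> c) xs" e] by simp
    also have "\<dots> \<le> \<beta> * norm d * norm e"
      using lipschitz_on_normD[OF lip_p ends(2,1)] unfolding d_def by (rule mult_right_mono) simp
    finally show "(grad x - grad xs) \<bullet> e \<le> \<beta> * norm d * norm e" .
  qed (use constants_nonneg in simp)
  have "J x e - J xs e = A *v ((deriv1 c x - deriv1 c xs) e)"
    by (simp add: J_def matrix_vector_mult_diff_distrib blinfun.diff_left)
  also have "norm \<dots> \<le> norm_A * (norm (deriv1 c x - deriv1 c xs) * norm e)"
    using constants_nonneg by (intro order_trans[OF norm_A_le] mult_left_mono norm_blinfun) auto
  also have "\<dots> \<le> norm_A * (\<beta>\<^sub>c * norm d * norm e)"
    using lipschitz_on_normD[OF lip_c ends(2,1)] constants_nonneg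
    unfolding d_def by (intro mult_left_mono mult_right_mono) auto
  finally show "norm (J x e - J xs e) \<le> \<kappa> * norm d * norm e" by (simp add: mult_ac)
qed

text \<open>The coefficient of the cubic error at feasible points, with \<open>L / \<gamma>\<close> as the bound on the
  multiplier.\<close>

definition cubic_error :: real where
  "cubic_error = \<rho> / 2 + L / \<gamma> * (norm_A * \<rho>\<^sub>c / 2) + (\<beta> + L / \<gamma> * \<kappa>) * \<kappa> / (2 * \<gamma>)"

text \<open>The smallness conditions on the distance do not involve \<open>lam\<close>. At infeasible points this is
  possible because \<open>lam \<ge> 2 L / \<gamma>\<close> bounds the curvature \<open>\<beta>\<close> of the objective by a multiple of
  \<open>lam\<close>.\<close>

lemma subgradient_estimates:
  assumes near: "infdist x S < \<epsilon>\<^sub>0"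
    and small: "(\<beta> * \<gamma> / (2 * L) + \<kappa>) * infdist x S \<le> \<gamma> / 2"
      "\<kappa> * infdist x S \<le> \<gamma>" "cubic_error * infdist x S \<le> \<alpha> / 4"
    and lam: "2 * L / \<gamma> \<le> lam"
    and w: "w \<in> composite_subdifferential (penalized f A b lam) c x"
  shows "penalized f A b lam (c x) - \<phi>\<^sub>s \<le> 2 * norm w * infdist x S"
    and "A *v c x \<noteq> b \<Longrightarrow> L \<le> norm w"
proof -
  obtain xs where xs: "xs \<in> S" and r: "infdist x S = norm (x - xs)"
    using infdist_attains_inf[OF compact_imp_closed[OF S_compact] S_nonempty] by (metis dist_norm)
  define d where "d = x - xs"
  have x: "x \<in> nbhd S \<epsilon>\<^sub>0" and dist: "dist x xs \<le> \<epsilon>\<^sub>0"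
    using near r by (auto simp: nbhd_def dist_norm)
  note taylor = taylor_estimates[OF xs dist, folded d_def]
  have lam_gamma: "2 * L \<le> lam * \<gamma>" using lam gamma_pos by (simp add: pos_divide_le_eq)
  have lam_nonneg: "0 \<le> lam" using lam L_pos gamma_pos by (smt (verit) divide_nonneg_pos)
  have "penalized f A b lam (c x) - \<phi>\<^sub>s \<le> 2 * norm w * norm d \<and> (A *v c x \<noteq> b \<longrightarrow> L \<le> norm w)"
  proof (cases "A *v c x = b")
    case True
    obtain z where z: "w = grad x + adjoint (J x) z"
      using subgradient_feasible[OF x True w] by blast
    obtain z0 where z0: "grad xs + adjoint (J xs) z0 = 0" "norm z0 \<le> L / \<gamma>"
      using multiplier_exists[OF xs] by blast
    have "f (c x) - \<phi>\<^sub>s \<le> 2 * norm w * norm d"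
    proof (rule feasible_point_estimate[OF linear_J linear_J gamma_pos constraint_qualification[OF x]
          z0 z taylor(3) _ _ taylor(5) taylor(6)])
      show "norm ((1/2) *\<^sub>R (J xs d + J x d)) \<le> norm_A * \<rho>\<^sub>c / 2 * norm d ^ 3"
        using taylor(4) unfolding True by (simp only: diff_self diff_0 norm_minus_cancel)
      show "norm (J x d) \<le> \<kappa> * (norm d)\<^sup>2"
        using taylor(2) unfolding True by (simp only: diff_self diff_0 norm_minus_cancel)
      show "\<alpha> / 2 * (norm d)\<^sup>2 \<le> f (c x) - \<phi>\<^sub>s"
        using quadratic_growth[OF x True] by (simp add: r d_def)
    qed (use small r in \<open>auto simp: cubic_error_def d_def\<close>)
    then show ?thesis using True by (simp add: penalized_def)
  next
    case False
    have "\<beta> \<le> \<beta> * \<gamma> / (2 * L) * lam"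
    proof -
      have "\<beta> * (2 * L) \<le> \<beta> * (lam * \<gamma>)"
        using lam_gamma constants_nonneg(2) by (rule mult_left_mono)
      then show ?thesis using L_pos by (simp add: field_simps)
    qed
    then have "\<beta> + lam * \<kappa> \<le> lam * (\<beta> * \<gamma> / (2 * L) + \<kappa>)"
      by (simp add: distrib_left mult.commute[of lam])
    then have "(\<beta> + lam * \<kappa>) * norm d \<le> lam * ((\<beta> * \<gamma> / (2 * L) + \<kappa>) * norm d)"
      unfolding mult.assoc[symmetric] by (rule mult_right_mono) simp
    also have "\<dots> \<le> lam * \<gamma> / 2"
      using mult_left_mono[OF small(1) lam_nonneg] by (simp add: r d_def)
    finally have "(\<beta> + lam * \<kappa>) * norm d \<le> lam * \<gamma> / 2" .
    note est = infeasible_point_estimates[OF linear_J constraint_qualification[OF x]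
        norm_grad_le[OF near] lam_gamma lam_nonneg refl _ subgradient_infeasible[OF x False w]
        taylor(1,2) this]
    have "lam * \<gamma> / 2 \<le> norm w" using est(1) False by simp
    then have "L \<le> norm w" using lam_gamma by linarith
    moreover have "f (c x) - \<phi>\<^sub>s + lam * norm (A *v c x - b) \<le> 2 * norm w * norm d"
      using est(2) False by simp
    ultimately show ?thesis by (simp add: penalized_def)
  qed
  then show "penalized f A b lam (c x) - \<phi>\<^sub>s \<le> 2 * norm w * infdist x S"
    and "A *v c x \<noteq> b \<Longrightarrow> L \<le> norm w"
    by (simp_all add: r d_def)
qed

text \<open>Off the feasible set quadratic growth says nothing, but there every subgradient is at least \<open>L\<close>
  long, so a bounded distance to \<open>S\<close> is enough.\<close>

lemma norm_convexity_and_regularity: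
  assumes near: "infdist x S < \<epsilon>\<^sub>0"
    and small: "(\<beta> * \<gamma> / (2 * L) + \<kappa>) * infdist x S \<le> \<gamma> / 2"
      "\<kappa> * infdist x S \<le> \<gamma>" "cubic_error * infdist x S \<le> \<alpha> / 4"
    and reach: "infdist x S \<le> 8 * L / \<alpha>"
    and lam: "2 * L / \<gamma> \<le> lam"
  defines "D \<equiv> infdist 0 (composite_subdifferential (penalized f A b lam) c x)"
  shows "penalized f A b lam (c x) - \<phi>\<^sub>s \<le> 2 * D * infdist x S"
    and "infdist x S \<le> 4 * 2 / \<alpha> * D"
proof -
  define r where "r = infdist x S"
  have r: "0 \<le> r" and D: "0 \<le> D" by (simp_all add: r_def D_def infdist_nonneg)
  have x: "x \<in> nbhd S \<epsilon>\<^sub>0" using near by (simp add: nbhd_def)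
  have "0 \<le> 2 * L / \<gamma>" using L_pos gamma_pos by simp
  then have ne: "composite_subdifferential (penalized f A b lam) c x \<noteq> {}"
    using lam by (intro composite_subdifferential_nonempty[OF x]) simp
  note est = subgradient_estimates[OF near small lam, folded r_def]
  show conv: "penalized f A b lam (c x) - \<phi>\<^sub>s \<le> 2 * D * infdist x S"
  proof (cases "r = 0")
    case True
    obtain w where "w \<in> composite_subdifferential (penalized f A b lam) c x" using ne by blast
    then show ?thesis using est(1) True by (simp add: r_def)
  next
    case False
    have "(penalized f A b lam (c x) - \<phi>\<^sub>s) / (2 * r) \<le> D"
      unfolding D_def
    proof (rule le_infdist[OF ne])
      fix w assume "w \<in> composite_subdifferential (penalized f A b lam) c x"
      then show "(penalized f A b lam (c x) - \<phi>\<^sub>s) / (2 * r) \<le> dist 0 w"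
        using est(1)[of w] r False by (simp add: pos_divide_le_eq mult_ac)
    qed
    then show ?thesis using r False by (simp add: pos_divide_le_eq mult_ac r_def)
  qed
  show "infdist x S \<le> 4 * 2 / \<alpha> * D"
  proof (cases "A *v c x = b")
    case True
    have "\<alpha> / 2 * r\<^sup>2 \<le> 2 * D * r"
      using conv quadratic_growth[OF x True] True by (simp add: penalized_def r_def)
    then have "r * (\<alpha> * r) \<le> r * (4 * D)" by (simp add: power2_eq_square mult_ac)
    then have "\<alpha> * r \<le> 8 * D"
      using r D by (cases "r = 0") (auto simp: mult_le_cancel_left)
    then show ?thesis using alpha_pos by (simp add: r_def pos_le_divide_eq mult_ac)
  next
    case False
    have "L \<le> D" unfolding D_def using ne est(2)[OF _ False] by (intro le_infdist) auto
    then have "8 * L / \<alpha> \<le> 8 * D / \<alpha>" using alpha_pos by (simp add: divide_right_mono)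
    then show ?thesis using reach by simp
  qed
qed

end

theorem theorem1:
  fixes c :: "real^'n \<Rightarrow> real^'m"
    and f :: "real^'m \<Rightarrow> real"
    and A :: "real^'m^'k"
    and b :: "real^'k"
    and S :: "(real^'n) set"
    and \<phi>\<^sub>s \<epsilon>\<^sub>0 \<alpha> \<gamma> L \<beta> \<rho> L\<^sub>c \<beta>\<^sub>c \<rho>\<^sub>c L\<^sub>f \<beta>\<^sub>f \<rho>\<^sub>f :: real
  assumes c_smooth: "C2_on UNIV c"
    and f_convex: "convex_on UNIV f"
    and eps0_pos: "0 < \<epsilon>\<^sub>0"
    and S_nonempty: "S \<noteq> {}"
    and S_feasible: "\<And>x. x \<in> S \<Longrightarrow> A *v c x = b"
    and S_value: "\<And>x. x \<in> S \<Longrightarrow> f (c x) = \<phi>\<^sub>s"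
    and S_minimal: "\<And>x. x \<in> nbhd S \<epsilon>\<^sub>0 \<Longrightarrow> A *v c x = b \<Longrightarrow> \<phi>\<^sub>s \<le> f (c x)"
    and L_pos: "0 < L"
    and obj_smooth: "smooth_with L \<beta> \<rho> (nbhd S \<epsilon>\<^sub>0) (f \<circ> c)"
    and c_smooth_with: "smooth_with L\<^sub>c \<beta>\<^sub>c \<rho>\<^sub>c (nbhd S \<epsilon>\<^sub>0) c"
    and c_deriv_lipschitz: "\<beta>\<^sub>c-lipschitz_on (nbhd S \<epsilon>\<^sub>0) (deriv1 c)"
    and f_smooth_with: "smooth_with L\<^sub>f \<beta>\<^sub>f \<rho>\<^sub>f (c ` nbhd S \<epsilon>\<^sub>0) f"
    and alpha_pos: "0 < \<alpha>"
    and quadratic_growth: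
      "\<And>x. x \<in> nbhd S \<epsilon>\<^sub>0 \<Longrightarrow> A *v c x = b \<Longrightarrow> \<phi>\<^sub>s + \<alpha> / 2 * (infdist x S)\<^sup>2 \<le> f (c x)"
    and gamma_pos: "0 < \<gamma>"
    and full_row_rank:
      "\<And>x. x \<in> nbhd S \<epsilon>\<^sub>0 \<Longrightarrow> rank (A ** transpose (nabla c x)) = CARD('k)"
    and sigma_min_bound:
      "\<And>x. x \<in> nbhd S \<epsilon>\<^sub>0 \<Longrightarrow> \<gamma> \<le> sigma_min (A ** transpose (nabla c x))"
    and S_compact: "compact S"
    and S_submanifold: "submanifold_of S {x. A *v c x = b}"
  shows "\<exists>l \<epsilon>. 0 < l \<and> l \<le> 5 \<and> 0 < \<epsilon> \<and>
    (\<forall>lam \<ge> threshold f c A S L \<gamma>.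
       (\<forall>x \<in> nbhd S \<epsilon>.
          penalized f A b lam (c x) - \<phi>\<^sub>s
            \<le> l * infdist 0 (composite_subdifferential (penalized f A b lam) c x) * infdist x S) \<and>
       (\<forall>x \<in> nbhd S \<epsilon>.
          infdist x S
            \<le> 4 * l / \<alpha> * infdist 0 (composite_subdifferential (penalized f A b lam) c x)))"
proof -
  interpret penalized_problem c f A b S \<phi>\<^sub>s \<epsilon>\<^sub>0 \<alpha> \<gamma> L \<beta> \<rho> L\<^sub>c \<beta>\<^sub>c \<rho>\<^sub>c L\<^sub>f \<beta>\<^sub>f \<rho>\<^sub>f
    by unfold_locales fact+
  \<comment> \<open>\<open>\<epsilon>\<close> has to meet finitely many conditions of the form \<open>K * \<epsilon> \<le> C\<close> with \<open>C > 0\<close>, and every sufficiently small \<open>\<epsilon>\<close> does.\<close>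
  define K1 where "K1 = \<beta> * \<gamma> / (2 * L) + \<kappa>"
  have "\<forall>\<^sub>F \<epsilon> in at_right 0. 0 < \<epsilon> \<and> 1 * \<epsilon> \<le> \<epsilon>\<^sub>0 / 2 \<and> K1 * \<epsilon> \<le> \<gamma> / 2
      \<and> \<kappa> * \<epsilon> \<le> \<gamma> \<and> cubic_error * \<epsilon> \<le> \<alpha> / 4 \<and> 1 * \<epsilon> \<le> 8 * L / \<alpha>"
    using eps0_pos gamma_pos alpha_pos L_pos
    by (intro eventually_conj eventually_at_right_0_mult_le eventually_at_right_less) auto
  then obtain \<epsilon> where \<epsilon>: "0 < \<epsilon>" "\<epsilon> \<le> \<epsilon>\<^sub>0 / 2" "K1 * \<epsilon> \<le> \<gamma> / 2" "\<kappa> * \<epsilon> \<le> \<gamma>"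
      "cubic_error * \<epsilon> \<le> \<alpha> / 4" "\<epsilon> \<le> 8 * L / \<alpha>"
    using eventually_happens'[OF trivial_limit_at_right_real] by force
  have nonneg: "0 \<le> K1" "0 \<le> \<kappa>" "0 \<le> cubic_error"
    using constants_nonneg L_pos gamma_pos by (auto simp: K1_def cubic_error_def)
  show ?thesis
  proof (rule exI[of _ 2], rule exI[of _ \<epsilon>], intro conjI allI impI ballI)
    fix lam x assume lam: "threshold f c A S L \<gamma> \<le> lam" and "x \<in> nbhd S \<epsilon>"
    then have r: "infdist x S \<le> \<epsilon>" by (simp add: nbhd_def)
    have "infdist x S < \<epsilon>\<^sub>0" "infdist x S \<le> 8 * L / \<alpha>" using r \<epsilon> eps0_pos by auto
    moreover have "K1 * infdist x S \<le> \<gamma> / 2" "\<kappa> * infdist x S \<le> \<gamma>" "cubic_error * infdist x S \<le> \<alpha> / 4"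
      using mult_left_mono[OF r] nonneg \<epsilon> order_trans by blast+
    moreover have "2 * L / \<gamma> \<le> lam" using lam by (simp add: threshold_def)
    ultimately show "penalized f A b lam (c x) - \<phi>\<^sub>s
            \<le> 2 * infdist 0 (composite_subdifferential (penalized f A b lam) c x) * infdist x S"
      and "infdist x S
            \<le> 4 * 2 / \<alpha> * infdist 0 (composite_subdifferential (penalized f A b lam) c x)"
      using norm_convexity_and_regularity[of x lam, folded K1_def] by blast+
  qed (use \<epsilon> in auto)
qed

end
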